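(* Let $0<\varepsilon\le 0.04$. Let $\mathcal{A}$ be any randomized $\mathsf{LOCAL}$ algorithm that, for every graph $G=(V,E)$, computes an independent set $I\subseteq V$ with $\mathbb{E}[|I|]\ge\alpha(G)-\varepsilon|V|$, where $\alpha(G)$ is the size of a maximum independent set of $G$. Then the round complexity of $\mathcal{A}$ is $\Omega\left(\frac{\log n}{\varepsilon}\right)$, where $n=|V|$.
   Context: The $\mathsf{LOCAL}$ model on the graph $G$: synchronous rounds; in each round every vertex receives messages from its neighbours, performs arbitrary local computation and sends arbitrarily large messages to its neighbours; vertices are anonymous and have independent local random bits; the exact number of vertices $n$ is known to all vertices. Each vertex outputs whether it is in $I$. *)

theory Defs
  imports "HOL-Probability.Probability"
begin

definition simple_graph :: "'v set \<Rightarrow> 'v set set \<Rightarrow> bool" where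
  "simple_graph V E \<longleftrightarrow> finite V \<and> (\<forall>e\<in>E. e \<subseteq> V \<and> card e = 2)"

definition independent_set :: "'v set \<Rightarrow> 'v set set \<Rightarrow> 'v set \<Rightarrow> bool" where
  "independent_set V E I \<longleftrightarrow> I \<subseteq> V \<and> (\<forall>u\<in>I. \<forall>v\<in>I. {u, v} \<notin> E)"

definition independence_number :: "'v set \<Rightarrow> 'v set set \<Rightarrow> nat" where
  "independence_number V E = Max (card ` {I. independent_set V E I})"

text \<open>Vertices are anonymous and address their neighbours through local ports: \<open>p v\<close> lists
  the neighbours of \<open>v\<close> in port order. The numbering is arbitrary, so an algorithm has to work
  for all of them; algorithms that do not use ports are those that ignore the order.\<close>

definition port_numbering :: "'v set \<Rightarrow> 'v set set \<Rightarrow> ('v \<Rightarrow> 'v list) \<Rightarrow> bool" where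
  "port_numbering V E p \<longleftrightarrow> (\<forall>v\<in>V. distinct (p v) \<and> set (p v) = {u. {v, u} \<in> E})"

definition port_to :: "('v \<Rightarrow> 'v list) \<Rightarrow> 'v \<Rightarrow> 'v \<Rightarrow> nat" where
  "port_to p u v = length (takeWhile (\<lambda>w. w \<noteq> v) (p u))"

text \<open>The initial state of a vertex depends on the number of vertices of the graph, its own
  degree and its own infinite string of random bits, and on nothing else. The types of states and
  messages are arbitrary, so neither local memory nor message size is restricted. A vertex
  may keep sending messages after it has decided.\<close>

record ('s, 'm) local_algorithm =
  init :: "nat \<Rightarrow> nat \<Rightarrow> (nat \<Rightarrow> bool) \<Rightarrow> 's"
  send :: "'s \<Rightarrow> nat \<Rightarrow> 'm"
  recv :: "'s \<Rightarrow> 'm list \<Rightarrow> 's"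
  decision :: "'s \<Rightarrow> bool option"

primrec state_after ::
  "('s, 'm) local_algorithm \<Rightarrow> 'v set \<Rightarrow> ('v \<Rightarrow> 'v list) \<Rightarrow> ('v \<Rightarrow> nat \<Rightarrow> bool) \<Rightarrow> nat \<Rightarrow> 'v \<Rightarrow> 's" where
  "state_after A V p \<omega> 0 v = init A (card V) (length (p v)) (\<omega> v)"
| "state_after A V p \<omega> (Suc t) v =
     recv A (state_after A V p \<omega> t v)
       (map (\<lambda>u. send A (state_after A V p \<omega> t u) (port_to p u v)) (p v))"

definition decided_by ::
  "('s, 'm) local_algorithm \<Rightarrow> 'v set \<Rightarrow> ('v \<Rightarrow> 'v list) \<Rightarrow> ('v \<Rightarrow> nat \<Rightarrow> bool) \<Rightarrow> nat \<Rightarrow> 'v \<Rightarrow> bool" where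
  "decided_by A V p \<omega> t v \<longleftrightarrow> (\<exists>s\<le>t. decision A (state_after A V p \<omega> s v) \<noteq> None)"

text \<open>Decisions are irrevocable: only the first one of a vertex counts.\<close>

definition output_set ::
  "('s, 'm) local_algorithm \<Rightarrow> 'v set \<Rightarrow> ('v \<Rightarrow> 'v list) \<Rightarrow> ('v \<Rightarrow> nat \<Rightarrow> bool) \<Rightarrow> 'v set" where
  "output_set A V p \<omega> =
     {v \<in> V. \<exists>t. decision A (state_after A V p \<omega> t v) = Some True \<and>
                 (\<forall>s<t. decision A (state_after A V p \<omega> s v) = None)}"

definition coin_flips :: "(nat \<Rightarrow> bool) measure" where
  "coin_flips = (\<Pi>\<^sub>M i\<in>UNIV. measure_pmf (bernoulli_pmf (1 / 2)))"

definition random_bits :: "'v set \<Rightarrow> ('v \<Rightarrow> nat \<Rightarrow> bool) measure" where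
  "random_bits V = (\<Pi>\<^sub>M v\<in>V. coin_flips)"

text \<open>In the remaining definitions graphs have their vertices in \<^typ>\<open>nat\<close>, which covers all finite
  graphs up to isomorphism.

  Since an algorithm reads infinite random strings through arbitrary functions, the
  measurability of its decisions, without which the expected size of the output
  has no meaning, is part of the notion of a randomized algorithm.\<close>

definition randomized_local_algorithm :: "('s, 'm) local_algorithm \<Rightarrow> bool" where
  "randomized_local_algorithm A \<longleftrightarrow>
     (\<forall>(V :: nat set) E p. simple_graph V E \<and> port_numbering V E p \<longrightarrow>
        (\<forall>v\<in>V. \<forall>t. (\<lambda>\<omega>. decision A (state_after A V p \<omega> t v))
                     \<in> random_bits V \<rightarrow>\<^sub>M count_space UNIV))"

definition runs_within :: "('s, 'm) local_algorithm \<Rightarrow> nat \<Rightarrow> nat \<Rightarrow> bool" where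
  "runs_within A n t \<longleftrightarrow>
     (\<forall>(V :: nat set) E p. simple_graph V E \<and> port_numbering V E p \<and> card V = n \<longrightarrow>
        (AE \<omega> in random_bits V. \<forall>v\<in>V. decided_by A V p \<omega> t v))"

text \<open>The infimum of the empty set is \<open>\<infinity>\<close>.\<close>

definition round_complexity :: "('s, 'm) local_algorithm \<Rightarrow> nat \<Rightarrow> enat" where
  "round_complexity A n = (INF t\<in>{t. runs_within A n t}. enat t)"

definition approximates_max_independent_set ::
  "('s, 'm) local_algorithm \<Rightarrow> real \<Rightarrow> bool" where
  "approximates_max_independent_set A \<epsilon> \<longleftrightarrow>
     (\<forall>(V :: nat set) E p. simple_graph V E \<and> port_numbering V E p \<longrightarrow>
        (AE \<omega> in random_bits V. independent_set V E (output_set A V p \<omega>)) \<and>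
        (\<integral>\<omega>. real (card (output_set A V p \<omega>)) \<partial>random_bits V)
          \<ge> real (independence_number V E) - \<epsilon> * real (card V))"

end

(*
  A vertex that sees no odd closed walk within t rounds cannot tell two disjoint copies of a
  graph from its bipartite double cover, although both have the same number of vertices.
  The double cover has an independent set of half of all vertices, so on the two copies, too,
  the algorithm must select almost half of them in expectation.

  This is impossible if the graph has independence ratio below 1/2 by more than the allowed
  error. A random multigraph with m vertices and 10 m edges has independence number at most
  0.4 m and only few sets of at most c ln m edges that are not forests; deleting one edge from
  each of these costs at most m/20. Replacing every edge by a path with an odd
  number, about 1/eps, of edges stretches the odd closed walks by this factor, while the gap
  between half of the vertices and the independence number remains proportional to m.
*)

theory Submission
  imports Defs
begin

section \<open>Locally sparse multigraphs with small independence number\<close>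

text \<open>The two lifts are compared vertex by vertex. For a fixed vertex, exchanging the sheets
  over all base vertices that an odd walk from it reaches permutes the independent bit strings so
  that this vertex has the same run in both lifts. The permutation depends on the vertex, so only
  acceptance probabilities of single vertices are matched; linearity of expectation makes this
  enough. Odd closed walks are excluded by colouring rather than by girth: a closed walk of fewer
  than \<open>(2 * q + 1) * (L + 1)\<close> steps covers at most \<open>L\<close> subdivided edges
  completely, and these form a forest, which is 2-colourable. The independence bound of the base has
  to tolerate edges inside the set, because an independent set of the subdivision may contain both
  ends of a base edge. Arbitrary \<open>n\<close> is reached by adding isolated vertices.\<close>

lemma card_PiE_image_subset:
  assumes "finite I" "F \<subseteq> I" "Q \<subseteq> P"
  shows "card {f \<in> I \<rightarrow>\<^sub>E P. f ` F \<subseteq> Q} = card Q ^ card F * card P ^ (card I - card F)"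
proof -
  have "{f \<in> I \<rightarrow>\<^sub>E P. f ` F \<subseteq> Q} = (\<Pi>\<^sub>E i\<in>I. if i \<in> F then Q else P)"
  proof (intro equalityI subsetI)
    fix f assume f: "f \<in> (\<Pi>\<^sub>E i\<in>I. if i \<in> F then Q else P)"
    have "f i \<in> (if i \<in> F then Q else P)" if "i \<in> I" for i
      using f that by (rule PiE_mem)
    then have "f i \<in> P \<and> (i \<in> F \<longrightarrow> f i \<in> Q)" if "i \<in> I" for i
      using that assms(3) by (metis subsetD)
    then show "f \<in> {f \<in> I \<rightarrow>\<^sub>E P. f ` F \<subseteq> Q}"
      using f assms(2) by (auto simp: PiE_iff)
  qed (use assms in \<open>auto simp: PiE_iff\<close>)
  moreover have "card (\<Pi>\<^sub>E i\<in>I. if i \<in> F then Q else P) = (\<Prod>i\<in>I. if i \<in> F then card Q else card P)"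
    using assms(1) by (subst card_PiE) (auto intro!: prod.cong)
  moreover have "\<dots> = card Q ^ card F * card P ^ (card I - card F)"
  proof -
    have "I \<inter> {i. i \<in> F} = F" "I \<inter> - {i. i \<in> F} = I - F" "card (I - F) = card I - card F"
      using assms by (auto intro: card_Diff_subset finite_subset)
    then show ?thesis
      using assms(1) by (simp add: prod.If_cases)
  qed
  ultimately show ?thesis by simp
qed

text \<open>A single term of the exponential series of \<open>l\<close> is at most
  \<open>exp l\<close>, and e \<le> 3. It is used to cancel the factorials of two binomials against
  \<open>(l * l) ^ l\<close>.\<close>

lemma self_power_le_fact: "real l ^ l \<le> 3 ^ l * fact l"
proof -
  have "real l ^ l / fact l \<le> exp (real l)"
  proof -
    have *: "(\<lambda>n. real l ^ n /\<^sub>R fact n) sums exp (real l)"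
      by (rule exp_converges)
    have "sum (\<lambda>n. real l ^ n /\<^sub>R fact n) {l} \<le> (\<Sum>n. real l ^ n /\<^sub>R fact n)"
      by (rule sum_le_suminf) (use * in \<open>auto simp: sums_iff\<close>)
    also have "\<dots> = exp (real l)"
      using * by (simp add: sums_iff)
    finally have "sum (\<lambda>n. real l ^ n /\<^sub>R fact n) {l} \<le> exp (real l)" .
    then show ?thesis by (simp add: field_simps)
  qed
  also have "\<dots> = exp 1 ^ l"
    by (simp flip: exp_of_nat_mult)
  also have "\<dots> \<le> 3 ^ l"
    by (intro power_mono) (use exp_le in auto)
  finally show ?thesis by (simp add: field_simps)
qed

text \<open>The sets of at most \<open>L\<close> edges with as many edges as vertices to live on. If none is
  left, then at most \<open>L\<close> edges always form a forest.\<close>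

definition dense_sets :: "nat \<Rightarrow> nat \<Rightarrow> nat \<Rightarrow> (nat \<Rightarrow> nat \<times> nat) \<Rightarrow> nat set set" where
  "dense_sets m M L f = {F. F \<subseteq> {..<M} \<and> card F \<in> {1..L} \<and>
     (\<exists>U\<subseteq>{..<m}. card U = card F \<and> f ` F \<subseteq> U \<times> U)}"

lemma sum_powers_90: "(\<Sum>l\<in>{1..L}. 90 ^ l) \<le> (180::real) ^ L"
proof (induction L)
  case (Suc L)
  have "(90::real) ^ L \<le> 180 ^ L" by (intro power_mono) auto
  moreover have "(\<Sum>l\<in>{1..Suc L}. 90 ^ l) = (\<Sum>l\<in>{1..L}. 90 ^ l) + 90 * (90::real) ^ L"
    by simp
  moreover have "(0::real) \<le> 180 ^ L" by simp
  ultimately show ?case using Suc unfolding power_Suc by linarith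
qed simp

text \<open>The left side counts triples of a set \<open>F\<close> of \<open>l\<close> slots (edge
  indices), a set \<open>U\<close> of \<open>l\<close> vertices and a map sending \<open>F\<close>
  into \<open>U \<times> U\<close>. Each binomial leaves \<open>l ^ l / fact l\<close>, a factor 3
  per slot; with 10 slots per vertex this makes 90 = 10 * 3 * 3.\<close>

lemma dense_term_le:
  fixes m l :: nat
  assumes "m > 0"
  shows "real ((10 * m choose l) * (m choose l) * ((l * l) ^ l * (m * m) ^ (10 * m - l)))
           \<le> 90 ^ l * (real m * real m) ^ (10 * m)"
proof (cases "l \<le> 10 * m")
  case False
  then have "(10 * m choose l) = 0" by (simp add: binomial_eq_0)
  then show ?thesis by (simp only: mult_zero_left of_nat_0) simp
next
  case True
  have a: "real (10 * m choose l) \<le> (10 * real m) ^ l / fact l"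
    using of_nat_mono[OF binomial_fact_pow[of "10 * m" l], where 'a = real]
    by (simp add: pos_le_divide_eq)
  have b: "real (m choose l) \<le> real m ^ l / fact l"
    using of_nat_mono[OF binomial_fact_pow[of m l], where 'a = real]
    by (simp add: pos_le_divide_eq)
  have c: "real l ^ l / fact l \<le> 3 ^ l"
    using self_power_le_fact[of l] by (simp add: pos_divide_le_eq)
  have "real ((10 * m choose l) * (m choose l) * ((l * l) ^ l * (m * m) ^ (10 * m - l)))
     \<le> ((10 * real m) ^ l / fact l) * (real m ^ l / fact l) * ((real l * real l) ^ l * (real m * real m) ^ (10 * m - l))"
    unfolding of_nat_mult of_nat_power
    by (intro mult_mono a b) auto
  also have "\<dots> = 10 ^ l * (real l ^ l / fact l) * (real l ^ l / fact l)
                  * ((real m * real m) ^ l * (real m * real m) ^ (10 * m - l))"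
    by (simp only: power_mult_distrib divide_inverse ac_simps)
  also have "(real m * real m) ^ l * (real m * real m) ^ (10 * m - l) = (real m * real m) ^ (10 * m)"
    using True by (simp flip: power_add)
  also have "10 ^ l * (real l ^ l / fact l) * (real l ^ l / fact l) * (real m * real m) ^ (10 * m)
     \<le> 10 ^ l * 3 ^ l * 3 ^ l * (real m * real m) ^ (10 * m)"
    by (intro mult_mono c) auto
  also have "(10::real) ^ l * 3 ^ l * 3 ^ l = 90 ^ l"
  proof -
    have "(10::real) ^ l * 3 ^ l * 3 ^ l = (10 * 3 * 3) ^ l"
      by (simp only: power_mult_distrib)
    then show ?thesis by simp
  qed
  finally show ?thesis .
qed

text \<open>A first moment bound: a uniformly random map has at most \<open>180 ^ L\<close> dense
  sets in expectation, however large \<open>m\<close> is. The base 180 instead of 90 absorbs the sum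
  over all sizes.\<close>

lemma sum_card_dense_sets_le:
  assumes "m > 0"
  shows "real (\<Sum>f\<in>{..<10*m} \<rightarrow>\<^sub>E {..<m} \<times> {..<m}. card (dense_sets m (10*m) L f))
           \<le> 180 ^ L * (real m * real m) ^ (10 * m)"
proof -
  define M where "M = 10 * m"
  define P where "P = {..<m} \<times> {..<m}"
  define \<Omega> where "\<Omega> = {..<M} \<rightarrow>\<^sub>E P"
  define Fs where "Fs l = {F. F \<subseteq> {..<M} \<and> card F = l}" for l
  define Us where "Us l = {U. U \<subseteq> {..<m} \<and> card U = l}" for l
  have fin: "finite (Fs l)" "finite (Us l)" "finite \<Omega>" for l
    by (auto simp: Fs_def Us_def \<Omega>_def P_def intro: finite_PiE)
  have cP: "card P = m * m" by (simp add: P_def)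
  have D: "card (dense_sets m M L f) \<le> (\<Sum>l\<in>{1..L}. \<Sum>F\<in>Fs l. \<Sum>U\<in>Us l. of_bool (f ` F \<subseteq> U \<times> U))" for f
  proof -
    have "dense_sets m M L f \<subseteq> (\<Union>l\<in>{1..L}. {F \<in> Fs l. \<exists>U\<in>Us l. f ` F \<subseteq> U \<times> U})"
    proof
      fix F assume "F \<in> dense_sets m M L f"
      then obtain U where "F \<in> Fs (card F)" "card F \<in> {1..L}" "U \<in> Us (card F)" "f ` F \<subseteq> U \<times> U"
        by (auto simp: dense_sets_def Fs_def Us_def)
      then show "F \<in> (\<Union>l\<in>{1..L}. {F \<in> Fs l. \<exists>U\<in>Us l. f ` F \<subseteq> U \<times> U})" by blast
    qed
    then have "card (dense_sets m M L f) \<le> card (\<Union>l\<in>{1..L}. {F \<in> Fs l. \<exists>U\<in>Us l. f ` F \<subseteq> U \<times> U})"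
      by (rule card_mono[rotated]) (use fin in auto)
    also have "\<dots> \<le> (\<Sum>l\<in>{1..L}. card {F \<in> Fs l. \<exists>U\<in>Us l. f ` F \<subseteq> U \<times> U})"
      by (rule card_UN_le) simp
    also have "\<dots> = (\<Sum>l\<in>{1..L}. \<Sum>F\<in>Fs l. of_bool (\<exists>U\<in>Us l. f ` F \<subseteq> U \<times> U))"
      using fin by (simp add: Int_def)
    also have "\<dots> \<le> (\<Sum>l\<in>{1..L}. \<Sum>F\<in>Fs l. \<Sum>U\<in>Us l. of_bool (f ` F \<subseteq> U \<times> U))"
    proof (intro sum_mono)
      fix l F
      show "of_bool (\<exists>U\<in>Us l. f ` F \<subseteq> U \<times> U) \<le> (\<Sum>U\<in>Us l. of_bool (f ` F \<subseteq> U \<times> U) :: nat)"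
      proof (cases "\<exists>U\<in>Us l. f ` F \<subseteq> U \<times> U")
        case True
        then obtain U where "U \<in> Us l" "f ` F \<subseteq> U \<times> U" by blast
        then show ?thesis
          using member_le_sum[of U "Us l" "\<lambda>U. of_bool (f ` F \<subseteq> U \<times> U) :: nat"] fin True by auto
      qed simp
    qed
    finally show ?thesis .
  qed
  have "(\<Sum>f\<in>\<Omega>. card (dense_sets m M L f))
      \<le> (\<Sum>f\<in>\<Omega>. \<Sum>l\<in>{1..L}. \<Sum>F\<in>Fs l. \<Sum>U\<in>Us l. of_bool (f ` F \<subseteq> U \<times> U))"
    by (intro sum_mono D)
  also have "\<dots> = (\<Sum>l\<in>{1..L}. \<Sum>F\<in>Fs l. \<Sum>U\<in>Us l. \<Sum>f\<in>\<Omega>. of_bool (f ` F \<subseteq> U \<times> U))"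
    by (subst sum.swap, intro sum.cong refl, subst sum.swap, intro sum.cong refl, rule sum.swap)
  also have "\<dots> = (\<Sum>l\<in>{1..L}. \<Sum>F\<in>Fs l. \<Sum>U\<in>Us l. (l * l) ^ l * (m * m) ^ (M - l))"
  proof (intro sum.cong refl)
    fix l F U assume F: "F \<in> Fs l" and U: "U \<in> Us l"
    have "(\<Sum>f\<in>\<Omega>. of_bool (f ` F \<subseteq> U \<times> U)) = card {f \<in> \<Omega>. f ` F \<subseteq> U \<times> U}"
      using fin by (simp add: Int_def)
    also have "\<dots> = card (U \<times> U) ^ card F * card P ^ (card {..<M} - card F)"
      unfolding \<Omega>_def
      by (rule card_PiE_image_subset) (use F U in \<open>auto simp: Fs_def Us_def P_def\<close>)
    finally show "(\<Sum>f\<in>\<Omega>. of_bool (f ` F \<subseteq> U \<times> U)) = (l * l) ^ l * (m * m) ^ (M - l)"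
      using F U by (simp add: Fs_def Us_def cP card_cartesian_product)
  qed
  also have "\<dots> = (\<Sum>l\<in>{1..L}. (M choose l) * (m choose l) * ((l * l) ^ l * (m * m) ^ (M - l)))"
    by (simp add: Fs_def Us_def n_subsets mult.assoc)
  finally have "real (\<Sum>f\<in>\<Omega>. card (dense_sets m M L f))
     \<le> real (\<Sum>l\<in>{1..L}. (M choose l) * (m choose l) * ((l * l) ^ l * (m * m) ^ (M - l)))"
    by (rule of_nat_mono)
  also have "\<dots> \<le> (\<Sum>l\<in>{1..L}. 90 ^ l * (real m * real m) ^ M)"
    unfolding of_nat_sum M_def by (intro sum_mono dense_term_le assms)
  also have "\<dots> \<le> 180 ^ L * (real m * real m) ^ M"
    unfolding sum_distrib_right[symmetric] by (intro mult_right_mono sum_powers_90) auto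
  finally show ?thesis by (simp add: \<Omega>_def M_def P_def)
qed

text \<open>Union bound over at most \<open>2 ^ m\<close> sets \<open>S\<close>. A random pair
  misses \<open>S \<times> S\<close> with probability at most 1 - 0.4^2 = 0.84, and 10 slots per
  vertex suffice because 2 * 0.84^10 < 0.4.\<close>

lemma card_avoiding_le:
  fixes m :: nat
  defines "\<Omega> \<equiv> {..<10*m} \<rightarrow>\<^sub>E {..<m} \<times> {..<m}"
  assumes "m > 0"
  shows "real (card {f \<in> \<Omega>. \<exists>S\<subseteq>{..<m}. real (card S) \<ge> 0.4 * m \<and> (\<forall>i<10*m. f i \<notin> S \<times> S)})
           \<le> 0.4 ^ m * (real m * real m) ^ (10 * m)"
proof -
  define P where "P = {..<m} \<times> {..<m}"
  define Ss where "Ss = {S. S \<subseteq> {..<m} \<and> real (card S) \<ge> 0.4 * m}"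
  have finS: "finite Ss" by (simp add: Ss_def)
  have finO: "finite \<Omega>" by (auto simp: \<Omega>_def intro: finite_PiE)
  have each: "real (card {f \<in> \<Omega>. \<forall>i<10*m. f i \<notin> S \<times> S}) \<le> 0.84 ^ (10 * m) * (real m * real m) ^ (10 * m)"
    if S: "S \<in> Ss" for S
  proof -
    have "{f \<in> \<Omega>. \<forall>i<10*m. f i \<notin> S \<times> S} = {..<10*m} \<rightarrow>\<^sub>E (P - S \<times> S)"
      by (intro equalityI subsetI) (auto simp: \<Omega>_def P_def PiE_iff)
    then have "card {f \<in> \<Omega>. \<forall>i<10*m. f i \<notin> S \<times> S} = card (P - S \<times> S) ^ (10 * m)"
      by (simp add: card_PiE)
    moreover
    have "real (card (P - S \<times> S)) \<le> 0.84 * (real m * real m)"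
    proof -
      have sub: "S \<times> S \<subseteq> P" "finite (S \<times> S)" 
        using S finite_subset[of S "{..<m}"] by (auto simp: P_def Ss_def)
      have "card (P - S \<times> S) = card P - card (S \<times> S)"
        by (rule card_Diff_subset) (use sub in auto)
      moreover have "card (S \<times> S) \<le> card P"
        by (rule card_mono) (use sub in \<open>auto simp: P_def\<close>)
      ultimately have "real (card (P - S \<times> S)) = real m * real m - real (card S) * real (card S)"
        by (simp add: P_def card_cartesian_product of_nat_diff)
      moreover have "real (card S) * real (card S) \<ge> (0.4 * m) * (0.4 * m)"
        using S by (intro mult_mono) (auto simp: Ss_def)
      ultimately show ?thesis by (simp add: algebra_simps)
    qed
    then have "real (card (P - S \<times> S)) ^ (10 * m) \<le> (0.84 * (real m * real m)) ^ (10 * m)"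
      by (rule power_mono) simp
    ultimately have "real (card {f \<in> \<Omega>. \<forall>i<10*m. f i \<notin> S \<times> S}) \<le> (0.84 * (real m * real m)) ^ (10 * m)"
      by (simp only: of_nat_power)
    then show ?thesis by (simp only: power_mult_distrib)
  qed
  have "{f \<in> \<Omega>. \<exists>S\<subseteq>{..<m}. real (card S) \<ge> 0.4 * m \<and> (\<forall>i<10*m. f i \<notin> S \<times> S)}
        = (\<Union>S\<in>Ss. {f \<in> \<Omega>. \<forall>i<10*m. f i \<notin> S \<times> S})"
    by (auto simp: Ss_def)
  then have "real (card {f \<in> \<Omega>. \<exists>S\<subseteq>{..<m}. real (card S) \<ge> 0.4 * m \<and> (\<forall>i<10*m. f i \<notin> S \<times> S)})
        \<le> real (\<Sum>S\<in>Ss. card {f \<in> \<Omega>. \<forall>i<10*m. f i \<notin> S \<times> S})"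
    using card_UN_le[OF finS] by (simp only: of_nat_le_iff)
  also have "\<dots> \<le> (\<Sum>S\<in>Ss. 0.84 ^ (10 * m) * (real m * real m) ^ (10 * m))"
    unfolding of_nat_sum by (intro sum_mono each)
  also have "\<dots> = real (card Ss) * (0.84 ^ (10 * m) * (real m * real m) ^ (10 * m))"
    by simp
  also have "\<dots> \<le> 2 ^ m * (0.84 ^ (10 * m) * (real m * real m) ^ (10 * m))"
  proof (rule mult_right_mono)
    have "card Ss \<le> card (Pow {..<m})"
      by (rule card_mono) (auto simp: Ss_def)
    then have "card Ss \<le> 2 ^ m" by (simp add: card_Pow)
    from of_nat_mono[OF this, where 'a = real] show "real (card Ss) \<le> 2 ^ m" by simp
  qed simp
  also have "\<dots> = (2 ^ m * 0.84 ^ (10 * m)) * (real m * real m) ^ (10 * m)"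
    by (rule mult.assoc[symmetric])
  also have "2 ^ m * 0.84 ^ (10 * m) = (2 * 0.84 ^ 10 :: real) ^ m"
    by (simp only: power_mult power_mult_distrib)
  also have "(2 * 0.84 ^ 10 :: real) ^ m * (real m * real m) ^ (10 * m) \<le> 0.4 ^ m * (real m * real m) ^ (10 * m)"
  proof (intro mult_right_mono power_mono)
    show "2 * 0.84 ^ 10 \<le> (0.4 :: real)" by (simp add: power_divide)
  qed simp_all
  finally show ?thesis .
qed

text \<open>Some map has neither more than m/20 dense sets nor a large set spanning no slot.
  \<open>B\<close> takes one slot from each dense set, so no dense set survives; 0.45 is 0.4 plus
  the 1/20 lost to \<open>B\<close>.\<close>

lemma sparse_multigraph_exists:
  fixes m L :: nat
  assumes m: "m > 1600" and L: "180 ^ L \<le> sqrt m"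
  obtains f B where
    "\<And>i. i < 10 * m \<Longrightarrow> f i \<in> {..<m} \<times> {..<m}"
    "\<And>S. S \<subseteq> {..<m} \<Longrightarrow>
       real (card S) \<le> 0.45 * m + card {i \<in> {..<10*m} - B. f i \<in> S \<times> S}"
    "\<And>F. F \<subseteq> {..<10*m} - B \<Longrightarrow> F \<noteq> {} \<Longrightarrow> card F \<le> L \<Longrightarrow>
       card F < card (\<Union>i\<in>F. {fst (f i), snd (f i)})"
proof -
  define \<Omega> where "\<Omega> = {..<10*m} \<rightarrow>\<^sub>E {..<m} \<times> {..<m}"
  define N where "N = (real m * real m) ^ (10 * m)"
  define bad1 where "bad1 = {f \<in> \<Omega>. real (card (dense_sets m (10*m) L f)) > m / 20}"
  define bad2 where "bad2 = {f \<in> \<Omega>. \<exists>S\<subseteq>{..<m}. real (card S) \<ge> 0.4 * m \<and> (\<forall>i<10*m. f i \<notin> S \<times> S)}"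
  have finO: "finite \<Omega>" by (auto simp: \<Omega>_def intro: finite_PiE)
  have cO: "real (card \<Omega>) = N"
    by (simp add: \<Omega>_def N_def card_PiE)
  have N0: "N > 0" using m by (simp add: N_def)
  \<comment> \<open>By Markov's inequality the first kind of bad map has frequency at most 20 /
    \<open>sqrt m\<close>, so 40 makes this one half.\<close>
  have sm: "sqrt m > 40" by (rule real_less_rsqrt) (use m in simp)
  have "real (card bad1) * (m / 20) \<le> (\<Sum>f\<in>bad1. real (card (dense_sets m (10*m) L f)))"
    by (rule order_trans[OF _ sum_bounded_below[of bad1 "m / 20"]]) (auto simp: bad1_def)
  also have "\<dots> \<le> (\<Sum>f\<in>\<Omega>. real (card (dense_sets m (10*m) L f)))"
    by (rule sum_mono2) (use finO in \<open>auto simp: bad1_def\<close>)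
  also have "\<dots> \<le> 180 ^ L * N"
    using sum_card_dense_sets_le[of m L] m by (simp add: \<Omega>_def N_def)
  also have "\<dots> \<le> sqrt m * N"
    using L N0 by (intro mult_right_mono) auto
  finally have "real (card bad1) * (sqrt m * sqrt m / 20) \<le> sqrt m * N" by simp
  then have "sqrt m * (real (card bad1) * sqrt m) \<le> sqrt m * (20 * N)" by (simp add: field_simps)
  then have b: "real (card bad1) * sqrt m \<le> 20 * N"
    by (rule mult_left_le_imp_le) (use m in simp)
  have "real (card bad1) * 40 \<le> real (card bad1) * sqrt m"
    by (intro mult_left_mono) (use sm in auto)
  with b have b1: "real (card bad1) \<le> N / 2" by simp
  have "real (card bad2) \<le> 0.4 ^ m * N"
    using card_avoiding_le[of m] m by (simp add: bad2_def \<Omega>_def N_def)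
  also have "(0.4::real) ^ m \<le> 0.4 ^ 1"
    by (rule power_decreasing) (use m in auto)
  then have "0.4 ^ m * N < N / 2" using N0 by simp
  finally have b2: "real (card bad2) < N / 2" .
  have "card (bad1 \<union> bad2) \<le> card bad1 + card bad2" by (rule card_Un_le)
  then have "real (card (bad1 \<union> bad2)) < real (card \<Omega>)" using b1 b2 cO by linarith
  then have "\<not> \<Omega> \<subseteq> bad1 \<union> bad2"
    using card_mono[of "bad1 \<union> bad2" \<Omega>] finO by (auto simp: bad1_def bad2_def)
  then obtain f where f: "f \<in> \<Omega>" "f \<notin> bad1" "f \<notin> bad2" by blast
  define pick where "pick F = (SOME i. i \<in> F)" for F :: "nat set"
  define B where "B = pick ` dense_sets m (10*m) L f"
  have finD: "finite (dense_sets m (10*m) L f)"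
    by (rule finite_subset[of _ "Pow {..<10*m}"]) (auto simp: dense_sets_def)
  have cB: "real (card B) \<le> m / 20"
  proof -
    have "card B \<le> card (dense_sets m (10*m) L f)"
      unfolding B_def by (rule card_image_le[OF finD])
    with f show ?thesis by (simp add: bad1_def not_less)
  qed
  have finB: "finite B" using finD by (simp add: B_def)
  have pickin: "pick F \<in> F" if "F \<in> dense_sets m (10*m) L f" for F
  proof -
    have "F \<noteq> {}" using that by (auto simp: dense_sets_def)
    then show ?thesis unfolding pick_def by (simp add: some_in_eq)
  qed
  have frng: "f i \<in> {..<m} \<times> {..<m}" if "i < 10 * m" for i
    using f(1) that by (auto simp: \<Omega>_def PiE_iff)
  show ?thesis
  proof (rule that[of f B])
    show "f i \<in> {..<m} \<times> {..<m}" if "i < 10 * m" for i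
      using frng that .
    show "real (card S) \<le> 0.45 * m + card {i \<in> {..<10*m} - B. f i \<in> S \<times> S}" if S: "S \<subseteq> {..<m}" for S
    proof -
      define R where "R = {i \<in> {..<10*m} - B. f i \<in> S \<times> S}"
      \<comment> \<open>Without the first endpoints of all slots inside \<open>S\<close> and of all
        slots in \<open>B\<close>, the remaining set spans no slot, so the 0.4 bound applies to
        it.\<close>
      define S' where "S' = S - (fst \<circ> f) ` (R \<union> B)"
      have fins: "finite R" "finite S" using S by (auto simp: R_def intro: finite_subset)
      have *: "f i \<notin> S' \<times> S'" if "i < 10 * m" for i
        using that by (cases "f i") (force simp: S'_def R_def)
      have "real (card S') < 0.4 * m"
      proof -
        have "\<not> (\<exists>S\<subseteq>{..<m}. real (card S) \<ge> 0.4 * m \<and> (\<forall>i<10*m. f i \<notin> S \<times> S))"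
          using f unfolding bad2_def by blast
        moreover have "S' \<subseteq> {..<m}" using S by (auto simp: S'_def)
        ultimately show ?thesis using * by (meson not_le)
      qed
      moreover have "card S \<le> card S' + card ((fst \<circ> f) ` (R \<union> B))"
        using diff_card_le_card_Diff[of "(fst \<circ> f) ` (R \<union> B)" S] fins finB by (simp add: S'_def)
      moreover have "card ((fst \<circ> f) ` (R \<union> B)) \<le> card (R \<union> B)"
        by (rule card_image_le) (use fins finB in auto)
      moreover have "card (R \<union> B) \<le> card R + card B" by (rule card_Un_le)
      ultimately show ?thesis using cB by (simp add: R_def)
    qed
    show "card F < card (\<Union>i\<in>F. {fst (f i), snd (f i)})"
      if F: "F \<subseteq> {..<10*m} - B" "F \<noteq> {}" "card F \<le> L" for F
    proof (rule ccontr)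
      define W where "W = (\<Union>i\<in>F. {fst (f i), snd (f i)})"
      assume "\<not> ?thesis"
      then have cW: "card W \<le> card F" by (simp add: W_def)
      have finF: "finite F" using F by (auto intro: finite_subset)
      have "fst (f i) < m \<and> snd (f i) < m" if "i \<in> F" for i
        using frng[of i] that F by (auto simp: mem_Times_iff)
      then have Wm: "W \<subseteq> {..<m}" by (auto simp: W_def)
      \<comment> \<open>Density asks for exactly \<open>card F\<close> vertices, so \<open>W\<close>
        has to be enlarged within \<open>{..<m}\<close>.\<close>
      have "L \<le> m"
      proof -
        have "real L \<le> 2 ^ L" using less_exp[of L] by (metis less_imp_le of_nat_le_iff of_nat_numeral of_nat_power)
        also have "\<dots> \<le> 180 ^ L" by (rule power_mono) auto
        also have "\<dots> \<le> sqrt m" by (rule L)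
        also have "\<dots> \<le> m" by (rule real_le_lsqrt) (use m in \<open>auto simp: power2_eq_square\<close>)
        finally show ?thesis by simp
      qed
      then obtain U where U: "W \<subseteq> U" "U \<subseteq> {..<m}" "card U = card F"
        using exists_subset_between[of W "card F" "{..<m}"] cW Wm F(3) by auto
      have "f ` F \<subseteq> U \<times> U"
        using U(1) unfolding W_def by (intro image_subsetI) (auto simp: mem_Times_iff)
      then have "F \<in> dense_sets m (10*m) L f"
        using F U finF card_gt_0_iff[of F] by (auto simp: dense_sets_def Suc_le_eq)
      then have "pick F \<in> B" "pick F \<in> F" by (auto simp: B_def pickin)
      then show False using F by auto
    qed
  qed
qed

section \<open>Subdivisions\<close>

text \<open>There are more vertices than edges, so counting endpoints yields a leaf. The rest is
  coloured by induction and the leaf gets the colour opposite to its neighbour. A loop would violate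
  the hypothesis for a single edge.\<close>

lemma two_colourable_if_sparse:
  fixes f :: "'i \<Rightarrow> 'v \<times> 'v"
  assumes "finite F"
    and "\<And>F'. F' \<subseteq> F \<Longrightarrow> F' \<noteq> {} \<Longrightarrow> card F' < card (\<Union>i\<in>F'. {fst (f i), snd (f i)})"
  shows "\<exists>c :: 'v \<Rightarrow> bool. \<forall>i\<in>F. c (fst (f i)) \<noteq> c (snd (f i))"
  using assms
proof (induction "card F" arbitrary: F)
  case 0
  then show ?case by auto
next
  case (Suc n)
  define ends where "ends i = {fst (f i), snd (f i)}" for i
  define W where "W = (\<Union>i\<in>F. ends i)"
  have finW: "finite W" using Suc.prems(1) by (auto simp: W_def ends_def)
  have "F \<noteq> {}" using Suc.hyps(2) by auto
  then have cW: "card F < card W"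
    using Suc.prems(2)[of F] by (simp add: W_def ends_def)
  have "\<exists>v\<in>W. card {i \<in> F. v \<in> ends i} < 2"
  proof (rule ccontr)
    assume "\<not> ?thesis"
    then have "card W * 2 \<le> (\<Sum>v\<in>W. card {i \<in> F. v \<in> ends i})"
      using sum_bounded_below[of W 2 "\<lambda>v. card {i \<in> F. v \<in> ends i}"] by (auto simp: not_less)
    also have "\<dots> = (\<Sum>v\<in>W. \<Sum>i\<in>F. of_bool (v \<in> ends i))"
      using Suc.prems(1) by (simp add: Int_def)
    also have "\<dots> = (\<Sum>i\<in>F. \<Sum>v\<in>W. of_bool (v \<in> ends i))"
      by (rule sum.swap)
    also have "\<dots> \<le> (\<Sum>i\<in>F. 2)"
    proof (rule sum_mono)
      fix i assume "i \<in> F"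
      have "(\<Sum>v\<in>W. of_bool (v \<in> ends i)) = card (W \<inter> ends i)"
        using finW by (simp add: Int_def)
      also have "\<dots> \<le> card (ends i)" by (rule card_mono) (auto simp: ends_def)
      also have "\<dots> \<le> 2" by (simp add: ends_def card_insert_if)
      finally show "(\<Sum>v\<in>W. of_bool (v \<in> ends i)) \<le> (2::nat)" .
    qed
    also have "\<dots> = card F * 2" by simp
    finally show False using cW by simp
  qed
  then obtain v where v: "v \<in> W" "card {i \<in> F. v \<in> ends i} < 2" by blast
  from v(1) obtain i where i: "i \<in> F" "v \<in> ends i" by (auto simp: W_def)
  have only: "k = i" if "k \<in> F" "v \<in> ends k" for k
  proof (rule ccontr)
    assume "k \<noteq> i"
    then have "card {i, k} \<le> card {i \<in> F. v \<in> ends i}"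
      using i that Suc.prems(1) by (intro card_mono) auto
    with v(2) \<open>k \<noteq> i\<close> show False by simp
  qed
  have noloop: "fst (f i) \<noteq> snd (f i)"
    using Suc.prems(2)[of "{i}"] i by auto
  have "\<exists>c :: 'v \<Rightarrow> bool. \<forall>k\<in>F - {i}. c (fst (f k)) \<noteq> c (snd (f k))"
  proof (rule Suc.hyps(1))
    show "n = card (F - {i})" using Suc.hyps(2) i Suc.prems(1) by simp
  next
    fix F' assume "F' \<subseteq> F - {i}" "F' \<noteq> {}"
    then show "card F' < card (\<Union>i\<in>F'. {fst (f i), snd (f i)})"
      by (intro Suc.prems(2)) auto
  qed (use Suc.prems in auto)
  then obtain c :: "'v \<Rightarrow> bool" where c: "\<forall>k\<in>F - {i}. c (fst (f k)) \<noteq> c (snd (f k))" by blast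
  define u where "u = (if v = fst (f i) then snd (f i) else fst (f i))"
  have "\<forall>k\<in>F. (c(v := \<not> c u)) (fst (f k)) \<noteq> (c(v := \<not> c u)) (snd (f k))"
  proof
    fix k assume k: "k \<in> F"
    show "(c(v := \<not> c u)) (fst (f k)) \<noteq> (c(v := \<not> c u)) (snd (f k))"
    proof (cases "k = i")
      case True
      then show ?thesis using i(2) noloop by (auto simp: u_def ends_def)
    next
      case False
      then have "v \<notin> ends k" using only k by blast
      then show ?thesis using c k False by (auto simp: ends_def)
    qed
  qed
  then show ?case by blast
qed

text \<open>Position \<open>j\<close> on the path of slot \<open>i\<close>, with the base vertices
  at both ends. The inner vertices of each path form a block of \<open>2 * q\<close> numbers from
  \<open>m\<close> on, so \<open>div\<close> and \<open>mod\<close> recover path and position; the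
  shift \<open>j - 1\<close> is there because inner positions start at 1.\<close>

definition subdiv_vertex :: "nat \<Rightarrow> nat \<Rightarrow> (nat \<Rightarrow> nat \<times> nat) \<Rightarrow> nat \<Rightarrow> nat \<Rightarrow> nat" where
  "subdiv_vertex m q f i j =
     (if j = 0 then fst (f i) else if j = 2 * q + 1 then snd (f i) else m + (i * (2 * q) + (j - 1)))"

text \<open>The edges in \<open>B\<close> are deleted by omitting only the first link of their paths, which
  keeps the number of inner vertices fixed.\<close>

definition subdivision :: "nat \<Rightarrow> nat \<Rightarrow> (nat \<Rightarrow> nat \<times> nat) \<Rightarrow> nat \<Rightarrow> nat set \<Rightarrow> (nat \<times> nat) set" where
  "subdivision m q f M B = {(x, y). \<exists>i<M. \<exists>j\<le>2*q. (i \<in> B \<longrightarrow> j \<noteq> 0) \<and>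
     {x, y} = {subdiv_vertex m q f i j, subdiv_vertex m q f i (Suc j)}}"

lemma sym_subdivision: "sym (subdivision m q f M B)"
  by (auto simp: sym_def subdivision_def insert_commute)

lemma subdiv_vertex_inner_less:
  assumes "i < M" "1 \<le> j" "j \<le> 2 * q"
  shows "subdiv_vertex m q f i j < m + 2 * q * M"
proof -
  have "i * (2 * q) + (j - 1) < i * (2 * q) + 2 * q" using assms by simp
  also have "\<dots> = Suc i * (2 * q)" by simp
  also have "\<dots> \<le> M * (2 * q)" using assms by (intro mult_right_mono) auto
  finally show ?thesis using assms by (simp add: subdiv_vertex_def mult.commute)
qed

lemma subdiv_vertex_less:
  assumes "\<And>i. i < M \<Longrightarrow> f i \<in> {..<m} \<times> {..<m}" "i < M" "j \<le> 2 * q + 1"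
  shows "subdiv_vertex m q f i j < m + 2 * q * M"
proof (cases "j = 0 \<or> j = 2 * q + 1")
  case True
  then show ?thesis using assms(1)[OF assms(2)] by (auto simp: subdiv_vertex_def mem_Times_iff)
next
  case False
  then show ?thesis using assms by (intro subdiv_vertex_inner_less) auto
qed

lemma subdivision_subset:
  assumes "\<And>i. i < M \<Longrightarrow> f i \<in> {..<m} \<times> {..<m}"
  shows "subdivision m q f M B \<subseteq> {..<m + 2 * q * M} \<times> {..<m + 2 * q * M}"
proof -
  have "x < m + 2 * q * M \<and> y < m + 2 * q * M" if "(x, y) \<in> subdivision m q f M B" for x y
  proof -
    from that obtain i j where ij: "i < M" "j \<le> 2 * q"
      "{x, y} = {subdiv_vertex m q f i j, subdiv_vertex m q f i (Suc j)}"
      by (auto simp: subdivision_def)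
    have "subdiv_vertex m q f i j < m + 2 * q * M" "subdiv_vertex m q f i (Suc j) < m + 2 * q * M"
      using ij by (auto intro!: subdiv_vertex_less assms)
    then show ?thesis using ij(3) by (auto simp: doubleton_eq_iff)
  qed
  then show ?thesis by auto
qed

text \<open>\<open>J\<close> is a set of links, given by slot and position. Only paths lying
  completely in \<open>J\<close> constrain the base colouring: their odd length forces different
  colours at the two ends.\<close>

lemma two_colouring_subdivision:
  fixes c :: "nat \<Rightarrow> bool"
  assumes f: "\<And>i. i < M \<Longrightarrow> f i \<in> {..<m} \<times> {..<m}"
    and J: "J \<subseteq> {..<M} \<times> {..2*q}"
    and c: "\<And>i::nat. i < M \<Longrightarrow> {i} \<times> {..2*q} \<subseteq> J \<Longrightarrow> c (fst (f i)) \<noteq> c (snd (f i))"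
  shows "\<exists>c' :: nat \<Rightarrow> bool. \<forall>(i, j)\<in>J. c' (subdiv_vertex m q f i j) = (\<not> c' (subdiv_vertex m q f i (Suc j)))"
proof -
  \<comment> \<open>On a path with a missing edge, the colours alternate from both ends up to that edge.\<close>
  define gap where "gap i = (SOME j. j \<le> 2 * q \<and> (i, j) \<notin> J)" for i
  define col where "col i j =
     (if {i} \<times> {..2*q} \<subseteq> J \<or> j \<le> gap i then c (fst (f i)) \<noteq> odd j
      else c (snd (f i)) \<noteq> even j)" for i j
  define c' where "c' x = (if x < m then c x else col ((x - m) div (2 * q)) ((x - m) mod (2 * q) + 1))" for x
  have gap: "gap i \<le> 2 * q \<and> (i, gap i) \<notin> J" if "\<not> {i} \<times> {..2*q} \<subseteq> J" for i
    unfolding gap_def by (rule someI_ex) (use that in auto)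
  let ?v = "subdiv_vertex m q f"
  have pos: "c' (subdiv_vertex m q f i j) = col i j" if ij: "i < M" "j \<le> 2 * q + 1" for i j
  proof -
    consider "j = 0" | "j = 2 * q + 1" | "1 \<le> j" "j \<le> 2 * q" using ij by linarith
    then show ?thesis
    proof cases
      case 1
      then show ?thesis using f[OF ij(1)]
        by (auto simp: subdiv_vertex_def c'_def col_def mem_Times_iff)
    next
      case 2
      have "c (snd (f i)) = col i j"
      proof (cases "{i} \<times> {..2*q} \<subseteq> J")
        case True
        then show ?thesis using c[OF ij(1)] 2 by (auto simp: col_def)
      next
        case False
        then show ?thesis using gap[of i] 2 by (auto simp: col_def)
      qed
      then show ?thesis using f[OF ij(1)] 2
        by (auto simp: subdiv_vertex_def c'_def mem_Times_iff)
    next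
      case 3
      have "(i * (2 * q) + (j - 1)) div (2 * q) = i" "(i * (2 * q) + (j - 1)) mod (2 * q) = j - 1"
      proof -
        have "j - 1 < 2 * q" using 3 by linarith
        then show "(i * (2 * q) + (j - 1)) div (2 * q) = i" "(i * (2 * q) + (j - 1)) mod (2 * q) = j - 1"
          by (metis add.commute add_0 div_less div_mult_self3 less_nat_zero_code, metis mod_less mod_mult_self3)
      qed
      moreover have "?v i j = m + (i * (2 * q) + (j - 1))" using 3 by (simp add: subdiv_vertex_def)
      ultimately have "c' (?v i j) = col i (j - 1 + 1)"
        unfolding c'_def by (simp only: diff_add_inverse) simp
      then show ?thesis using 3 by simp
    qed
  qed
  have "c' (subdiv_vertex m q f i j) = (\<not> c' (subdiv_vertex m q f i (Suc j)))" if "(i, j) \<in> J" for i j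
  proof -
    have ij: "i < M" "j \<le> 2 * q" using that J by auto
    have "col i j = (\<not> col i (Suc j))"
    proof (cases "{i} \<times> {..2*q} \<subseteq> J")
      case True
      then show ?thesis by (auto simp: col_def)
    next
      case False
      with gap[of i] that have "j \<noteq> gap i" by auto
      with False show ?thesis by (auto simp: col_def)
    qed
    then show ?thesis using ij by (simp add: pos)
  qed
  then show ?thesis by blast
qed

text \<open>The colouring is built only for the links the walk uses. Counting links leaves at most
  \<open>L\<close> complete paths, whose slots are 2-colourable by sparsity; the colouring extends
  to all used links and alternates along the walk, so its length is even.\<close>

lemma subdivision_no_odd_closed_walk:
  assumes f: "\<And>i. i < M \<Longrightarrow> f i \<in> {..<m} \<times> {..<m}"
    and sparse: "\<And>F. F \<subseteq> {..<M} - B \<Longrightarrow> F \<noteq> {} \<Longrightarrow> card F \<le> L \<Longrightarrow>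
       card F < card (\<Union>i\<in>F. {fst (f i), snd (f i)})"
    and k: "odd k" "k < (2 * q + 1) * (L + 1)"
  shows "(x, x) \<notin> subdivision m q f M B ^^ k"
proof
  let ?v = "subdiv_vertex m q f"
  assume "(x, x) \<in> subdivision m q f M B ^^ k"
  then obtain g where g: "g 0 = x" "g k = x" "\<And>a. a < k \<Longrightarrow> (g a, g (Suc a)) \<in> subdivision m q f M B"
    by (auto simp: relpow_fun_conv)
  \<comment> \<open>The same two vertices may be joined by more than one link. One link is chosen
    for each step, and only the chosen ones enter \<open>J\<close>.\<close>
  define ok where "ok a e \<longleftrightarrow> fst e < M \<and> snd e \<le> 2 * q \<and> (fst e \<in> B \<longrightarrow> snd e \<noteq> 0) \<and>
     {g a, g (Suc a)} = {?v (fst e) (snd e), ?v (fst e) (Suc (snd e))}" for a e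
  have "\<forall>a. \<exists>e. a < k \<longrightarrow> ok a e"
    using g(3) unfolding subdivision_def ok_def by fastforce
  then obtain e where e: "\<And>a. a < k \<Longrightarrow> ok a (e a)" by metis
  define J where "J = e ` {..<k}"
  define F where "F = {i \<in> {..<M}. {i} \<times> {..2*q} \<subseteq> J}"
  have J: "J \<subseteq> {..<M} \<times> {..2*q}"
    using e unfolding J_def ok_def by (intro image_subsetI) (simp add: mem_Times_iff)
  have "card (F \<times> {..2*q}) \<le> card J"
    by (rule card_mono) (auto simp: J_def F_def)
  also have "\<dots> \<le> k" unfolding J_def using card_image_le[of "{..<k}" e] by simp
  also have "\<dots> < (2 * q + 1) * (L + 1)" by (rule k)
  finally have "card F * (2 * q + 1) < (L + 1) * (2 * q + 1)"
    by (simp add: card_cartesian_product mult.commute)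
  then have "card F < L + 1" by (rule mult_right_less_imp_less) simp
  then have FL: "card F \<le> L" by simp
  \<comment> \<open>The first link of a deleted slot is absent, so no walk covers its path
    completely.\<close>
  have FB: "F \<subseteq> {..<M} - B"
  proof
    fix i assume "i \<in> F"
    then have i: "i < M" "(i, 0) \<in> J" by (auto simp: F_def)
    then obtain a where "a < k" "(i, 0) = e a" by (auto simp: J_def)
    with e[of a] have "i \<notin> B" by (metis fst_conv ok_def snd_conv)
    with i show "i \<in> {..<M} - B" by simp
  qed
  have finF: "finite F" by (simp add: F_def)
  have "\<exists>c :: nat \<Rightarrow> bool. \<forall>i\<in>F. c (fst (f i)) \<noteq> c (snd (f i))"
  proof (rule two_colourable_if_sparse[OF finF])
    fix F' assume F': "F' \<subseteq> F" "F' \<noteq> {}"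
    show "card F' < card (\<Union>i\<in>F'. {fst (f i), snd (f i)})"
      by (rule sparse) (use F' FB FL card_mono[OF finF F'(1)] in auto)
  qed
  then obtain c :: "nat \<Rightarrow> bool" where "\<forall>i\<in>F. c (fst (f i)) \<noteq> c (snd (f i))" by blast
  then have "\<exists>c'. \<forall>(i, j)\<in>J. c' (?v i j) = (\<not> c' (?v i (Suc j)))"
    by (intro two_colouring_subdivision[where c = c and M = M] f J) (auto simp: F_def)
  then obtain c' where c': "\<And>i j. (i, j) \<in> J \<Longrightarrow> c' (?v i j) = (\<not> c' (?v i (Suc j)))" by blast
  have flip: "c' (g (Suc a)) = (\<not> c' (g a))" if "a < k" for a
  proof -
    have "(fst (e a), snd (e a)) \<in> J" using that by (simp add: J_def)
    from c'[OF this] show ?thesis using e[OF that] by (auto simp: ok_def doubleton_eq_iff)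
  qed
  have "a \<le> k \<Longrightarrow> c' (g a) = (c' x \<noteq> odd a)" for a
    by (induction a) (auto simp: g flip)
  from this[of k] show False using g k by simp
qed

lemma subdivision_irrefl:
  assumes "\<And>i. i < M \<Longrightarrow> f i \<in> {..<m} \<times> {..<m}"
    and "\<And>F. F \<subseteq> {..<M} - B \<Longrightarrow> F \<noteq> {} \<Longrightarrow> card F \<le> L \<Longrightarrow>
       card F < card (\<Union>i\<in>F. {fst (f i), snd (f i)})"
    and "L > 0"
  shows "(x, x) \<notin> subdivision m q f M B"
  using subdivision_no_odd_closed_walk[OF assms(1,2), where k = 1 and x = x and q = q] assms(3) by simp

section \<open>Independent sets of a subdivision\<close>

lemma card_no_consecutive_le:
  fixes A :: "nat set"
  assumes "A \<subseteq> {1..2*q}" "\<And>j. j \<in> A \<Longrightarrow> Suc j \<notin> A"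
  shows "card A \<le> q"
proof -
  have "inj_on (\<lambda>j. (j + 1) div 2) A"
  proof (rule inj_onI)
    fix i j assume ij: "i \<in> A" "j \<in> A" "(i + 1) div 2 = (j + 1) div 2"
    then have "i = j \<or> i = Suc j \<or> j = Suc i" by linarith
    with assms(2) ij show "i = j" by blast
  qed
  moreover have "(\<lambda>j. (j + 1) div 2) ` A \<subseteq> {1..q}" using assms(1) by fastforce
  ultimately have "card A \<le> card {1..q}" by (rule card_inj_on_le) simp
  then show ?thesis by simp
qed

text \<open>When both base ends are chosen, positions 1 and \<open>2 * q\<close> are blocked. The
  others pair up as {2, 3}, {4, 5}, ..., which is one pair fewer than for a free path.\<close>

lemma card_no_consecutive_less:
  fixes A :: "nat set"
  assumes "q > 0" "A \<subseteq> {2..<2*q}" "\<And>j. j \<in> A \<Longrightarrow> Suc j \<notin> A"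
  shows "card A < q"
proof -
  have "inj_on (\<lambda>j. j div 2) A"
  proof (rule inj_onI)
    fix i j :: nat assume ij: "i \<in> A" "j \<in> A" "i div 2 = j div 2"
    then have "i = j \<or> i = Suc j \<or> j = Suc i" by linarith
    with assms(3) ij show "i = j" by blast
  qed
  moreover have "(\<lambda>j. j div 2) ` A \<subseteq> {1..<q}" using assms(2) by fastforce
  ultimately have "card A \<le> card {1..<q}" by (rule card_inj_on_le) simp
  then show ?thesis using assms(1) by simp
qed

text \<open>Every path contributes at most \<open>q\<close> inner vertices, also for deleted slots,
  whose inner links remain. A surviving slot with both ends in \<open>I\<close> contributes one
  less, which pays exactly for its occurrence in the count of \<open>base\<close>. The last
  \<open>r\<close> vertices are padding and counted in full.\<close>

lemma card_independent_subdivision_le: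
  assumes f: "\<And>i. i < M \<Longrightarrow> f i \<in> {..<m} \<times> {..<m}"
    and base: "\<And>S. S \<subseteq> {..<m} \<Longrightarrow>
       real (card S) \<le> (a::real) + card {i \<in> {..<M} - B. f i \<in> S \<times> S}"
    and I: "I \<subseteq> {..<m + 2 * q * M + r}"
    and indep: "\<And>x y. x \<in> I \<Longrightarrow> y \<in> I \<Longrightarrow> (x, y) \<notin> subdivision m q f M B"
  shows "real (card I) \<le> a + q * M + r"
proof -
  let ?v = "subdiv_vertex m q f"
  define S where "S = I \<inter> {..<m}"
  define X where "X = {i \<in> {..<M} - B. f i \<in> S \<times> S}"
  define A where "A i = {j \<in> {1..2*q}. ?v i j \<in> I}" for i
  have consec: "\<not> (?v i j \<in> I \<and> ?v i (Suc j) \<in> I)" if "i < M" "j \<le> 2 * q" "i \<in> B \<longrightarrow> j \<noteq> 0" for i j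
    using indep[of "?v i j" "?v i (Suc j)"] that by (auto simp: subdivision_def)
  have A1: "card (A i) \<le> q" if "i < M" for i
    by (rule card_no_consecutive_le) (use consec that in \<open>auto simp: A_def\<close>)
  have A2: "card (A i) < q" if "i \<in> X" for i
  proof -
    have i: "i < M" "i \<notin> B" "?v i 0 \<in> I" "?v i (Suc (2 * q)) \<in> I"
      using that by (auto simp: X_def S_def subdiv_vertex_def mem_Times_iff)
    have q: "q > 0" using consec[of i 0] i by (cases "q = 0") auto
    have 1: "?v i 1 \<notin> I" "?v i (2 * q) \<notin> I"
      using consec[of i 0] consec[of i "2 * q"] i by auto
    show ?thesis
    proof (rule card_no_consecutive_less[OF q])
      show "A i \<subseteq> {2..<2*q}"
      proof
        fix j assume j: "j \<in> A i"
        with 1 have "j \<noteq> 1" "j \<noteq> 2 * q" by (auto simp: A_def)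
        with j show "j \<in> {2..<2*q}" by (auto simp: A_def)
      qed
      show "Suc j \<notin> A i" if "j \<in> A i" for j
        using consec[of i j] i that by (auto simp: A_def)
    qed
  qed
  have finX: "finite X" by (simp add: X_def)
  have "I \<subseteq> S \<union> (\<Union>i\<in>{..<M}. ?v i ` A i) \<union> {m + 2 * q * M..<m + 2 * q * M + r}"
  proof
    fix x assume x: "x \<in> I"
    consider "x < m" | "m \<le> x" "x < m + 2 * q * M" | "m + 2 * q * M \<le> x" by linarith
    then show "x \<in> S \<union> (\<Union>i\<in>{..<M}. ?v i ` A i) \<union> {m + 2 * q * M..<m + 2 * q * M + r}"
    proof cases
      case 2
      define i j where "i = (x - m) div (2 * q)" and "j = (x - m) mod (2 * q) + 1"
      have q: "q > 0" using 2 by (cases "q = 0") auto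
      have "x - m < M * (2 * q)" using 2 by (simp add: mult.commute)
      then have i: "i < M" unfolding i_def by (simp add: less_mult_imp_div_less)
      have j: "1 \<le> j" "j \<le> 2 * q" using q mod_less_divisor[of "2 * q" "x - m"] by (auto simp: j_def Suc_le_eq)
      have "i * (2 * q) + (j - 1) = x - m" by (simp only: i_def j_def diff_add_inverse2 div_mult_mod_eq)
      then have "?v i j = x" using j 2 by (simp add: subdiv_vertex_def)
      then show ?thesis using x i j by (auto simp: A_def)
    qed (use x I in \<open>auto simp: S_def\<close>)
  qed
  then have "card I \<le> card (S \<union> (\<Union>i\<in>{..<M}. ?v i ` A i) \<union> {m + 2 * q * M..<m + 2 * q * M + r})"
    by (rule card_mono[rotated]) (auto simp: S_def A_def)
  also have "\<dots> \<le> card S + card (\<Union>i\<in>{..<M}. ?v i ` A i) + r"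
    using card_Un_le[of "S \<union> (\<Union>i\<in>{..<M}. ?v i ` A i)" "{m + 2 * q * M..<m + 2 * q * M + r}"]
      card_Un_le[of S "\<Union>i\<in>{..<M}. ?v i ` A i"] by simp
  also have "card (\<Union>i\<in>{..<M}. ?v i ` A i) \<le> (\<Sum>i\<in>{..<M}. card (A i))"
    by (rule order_trans[OF card_UN_le]) (auto intro!: sum_mono card_image_le simp: A_def)
  finally have 1: "card I \<le> card S + (\<Sum>i<M. card (A i)) + r" by simp
  have "(\<Sum>i<M. card (A i)) + card X = (\<Sum>i<M. card (A i) + of_bool (i \<in> X))"
  proof -
    have "{..<M} \<inter> X = X" by (auto simp: X_def)
    then show ?thesis by (simp add: sum.distrib Int_def)
  qed
  also have "\<dots> \<le> (\<Sum>i<M. q)"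
    by (intro sum_mono) (use A1 A2 in \<open>auto simp: Suc_le_eq\<close>)
  also have "\<dots> = q * M" by simp
  finally have "(\<Sum>i<M. card (A i)) + card X \<le> q * M" .
  then have 2: "card I + card X \<le> card S + q * M + r" using 1 by linarith
  have "real (card S) \<le> a + card X"
    unfolding X_def by (rule base) (auto simp: S_def)
  moreover have "real (card I) + real (card X) \<le> real (card S) + real (q * M) + real r"
    using 2 by (metis of_nat_add of_nat_le_iff)
  ultimately show ?thesis by simp
qed

section \<open>Two copies and the bipartite double cover\<close>

text \<open>The vertices of a lift are \<open>2 * x\<close> and \<open>2 * x + 1\<close>, on two sheets over \<open>x\<close>. The lift is
  the double cover if \<open>d\<close> holds, and two disjoint copies otherwise.\<close>

definition lift :: "(nat \<times> nat) set \<Rightarrow> bool \<Rightarrow> (nat \<times> nat) set" where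
  "lift R d = {(v, u). (v div 2, u div 2) \<in> R \<and> (odd u \<noteq> odd v) = d}"

definition lift_edges :: "(nat \<times> nat) set \<Rightarrow> bool \<Rightarrow> nat set set" where
  "lift_edges R d = {{v, u} | v u. (v, u) \<in> lift R d}"

text \<open>Neighbours are ordered by their base vertex alone, so the vertices over one base vertex
  use the same port order in both lifts.\<close>

definition lift_ports :: "(nat \<times> nat) set \<Rightarrow> bool \<Rightarrow> nat \<Rightarrow> nat list" where
  "lift_ports R d v = map (\<lambda>y. 2 * y + of_bool (odd v \<noteq> d)) (sorted_list_of_set (R `` {v div 2}))"

lemma double_plus_of_bool_eq_iff: "2 * y + of_bool b = (u::nat) \<longleftrightarrow> y = u div 2 \<and> odd u = b"
  by (cases b) (auto elim: oddE)

lemma sym_lift: "sym R \<Longrightarrow> sym (lift R d)"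
  by (auto simp: lift_def sym_def)

lemma in_lift_edges_iff: "sym R \<Longrightarrow> {v, u} \<in> lift_edges R d \<longleftrightarrow> (v, u) \<in> lift R d"
  using sym_lift[of R d] by (auto simp: lift_edges_def doubleton_eq_iff dest: symD)

text \<open>The vertices over \<open>{..<n div 2}\<close> are those below
  \<open>2 * (n div 2)\<close>. For odd \<open>n\<close> the vertex \<open>n - 1\<close> is left
  over and isolated, so both lifts have exactly \<open>n\<close> vertices.\<close>

locale base_graph =
  fixes R :: "(nat \<times> nat) set" and n :: nat
  assumes sym: "sym R" and irrefl: "(x, x) \<notin> R"
    and R_subset: "R \<subseteq> {..<n div 2} \<times> {..<n div 2}"
begin

lemma lift_less: "(v, u) \<in> lift R d \<Longrightarrow> v < n \<and> u < n"
  using R_subset by (fastforce simp: lift_def)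

lemma finite_neighbours: "finite (R `` {x})"
  by (rule finite_subset[of _ "{..<n div 2}"]) (use R_subset in auto)

lemma simple_graph_lift: "simple_graph {..<n} (lift_edges R d)"
proof -
  have "v \<noteq> u" if "(v, u) \<in> lift R d" for v u
    using that irrefl by (auto simp: lift_def)
  then show ?thesis
    using lift_less by (auto simp: simple_graph_def lift_edges_def)
qed

lemma set_lift_ports: "set (lift_ports R d v) = {u. (v, u) \<in> lift R d}"
proof -
  have "set (lift_ports R d v) = (\<lambda>y. 2 * y + of_bool (odd v \<noteq> d)) ` (R `` {v div 2})"
    using finite_neighbours by (simp add: lift_ports_def)
  also have "\<dots> = {u. (v, u) \<in> lift R d}"
  proof (rule set_eqI)
    fix u
    have "u \<in> (\<lambda>y. 2 * y + of_bool (odd v \<noteq> d)) ` (R `` {v div 2})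
        \<longleftrightarrow> (\<exists>y. (v div 2, y) \<in> R \<and> 2 * y + of_bool (odd v \<noteq> d) = u)" by blast
    then show "u \<in> (\<lambda>y. 2 * y + of_bool (odd v \<noteq> d)) ` (R `` {v div 2}) \<longleftrightarrow> u \<in> {u. (v, u) \<in> lift R d}"
      by (simp only: double_plus_of_bool_eq_iff) (auto simp: lift_def)
  qed
  finally show ?thesis .
qed

lemma port_numbering_lift: "port_numbering {..<n} (lift_edges R d) (lift_ports R d)"
proof -
  have "distinct (lift_ports R d v)" for v
    by (auto simp: lift_ports_def distinct_map inj_on_def)
  then show ?thesis
    by (simp add: port_numbering_def set_lift_ports in_lift_edges_iff sym)
qed

text \<open>All neighbours of \<open>u\<close> lie on one sheet, so finding \<open>v\<close> among
  them amounts to finding its base vertex. The result mentions neither sheet nor \<open>d\<close>,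
  hence messages leave through the same port in both lifts.\<close>

lemma port_to_lift:
  assumes "(v, u) \<in> lift R d"
  shows "port_to (lift_ports R d) u v =
    length (takeWhile (\<lambda>y. y \<noteq> v div 2) (sorted_list_of_set (R `` {u div 2})))"
proof -
  have "(2 * y + of_bool (odd u \<noteq> d) \<noteq> v) \<longleftrightarrow> y \<noteq> v div 2" for y
    using assms by (subst double_plus_of_bool_eq_iff) (auto simp: lift_def)
  then show ?thesis
    by (simp add: port_to_def lift_ports_def takeWhile_map o_def)
qed

section \<open>Coupling the runs on the two lifts around a vertex\<close>

text \<open>Exchanging the two sheets over the vertices at odd distance from \<open>x\<close> turns the
  double cover into two copies, as far as vertices close to \<open>x\<close> can see.\<close>

definition odd_from :: "nat \<Rightarrow> nat \<Rightarrow> nat \<Rightarrow> bool" where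
  "odd_from x T u \<longleftrightarrow> (\<exists>k\<le>T. odd k \<and> (x, u) \<in> R ^^ k)"

definition switch :: "nat \<Rightarrow> nat \<Rightarrow> nat \<Rightarrow> nat" where
  "switch x T v = 2 * (v div 2) + of_bool (odd v \<noteq> odd_from x T (v div 2))"

lemma switch_div_2 [simp]: "switch x T v div 2 = v div 2"
  by (simp add: switch_def)

lemma even_switch [simp]: "even (switch x T v) \<longleftrightarrow> odd v = odd_from x T (v div 2)"
  by (simp add: switch_def)

lemma switch_switch [simp]: "switch x T (switch x T v) = v"
proof -
  have "switch x T (switch x T v) = 2 * (v div 2) + of_bool (odd v)"
    unfolding switch_def[of x T "switch x T v"] by simp
  then show ?thesis by (cases "odd v") auto
qed

lemma relpow_sym: "(a, b) \<in> R ^^ k \<Longrightarrow> (b, a) \<in> R ^^ k"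
proof (induction k arbitrary: b)
  case (Suc k)
  then obtain c where "(a, c) \<in> R ^^ k" "(c, b) \<in> R" by auto
  then have "(c, a) \<in> R ^^ k" "(b, c) \<in> R" using Suc.IH sym by (auto dest: symD)
  then show ?case by (rule relpow_Suc_I2[rotated])
qed simp

lemma switch_less: "v < n \<Longrightarrow> switch x T v < n"
proof (cases "odd_from x T (v div 2)")
  case True
  then obtain k where "odd k" "(x, v div 2) \<in> R ^^ k" by (auto simp: odd_from_def)
  then obtain y where "(y, v div 2) \<in> R" by (cases k) auto
  then have "v div 2 < n div 2" using R_subset by auto
  then show ?thesis by (auto simp: switch_def)
next
  case False
  then have "switch x T v = v"
    by (cases "odd v") (auto simp: switch_def)
  then show "v < n \<Longrightarrow> switch x T v < n" by simp
qed

text \<open>Two walks from \<open>x\<close> to \<open>u\<close> of different parity would close up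
  to an odd closed walk of length at most \<open>2 * T\<close>. Hence the factor 2 in the
  hypothesis.\<close>

lemma odd_from_iff:
  assumes "\<And>k x. odd k \<Longrightarrow> k \<le> 2 * T \<Longrightarrow> (x, x) \<notin> R ^^ k"
    and "(x, u) \<in> R ^^ k" "k \<le> T"
  shows "odd_from x T u \<longleftrightarrow> odd k"
proof
  assume "odd_from x T u"
  then obtain l where l: "l \<le> T" "odd l" "(x, u) \<in> R ^^ l" by (auto simp: odd_from_def)
  have "(x, x) \<in> R ^^ (l + k)"
    using l(3) relpow_sym[OF assms(2)] by (auto simp: relpow_add)
  with assms(1)[of "l + k" x] l assms(3) show "odd k" by auto
qed (use assms in \<open>auto simp: odd_from_def\<close>)

text \<open>The budget \<open>k + s \<le> T\<close> drives the induction: a neighbour is one step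
  further from \<open>x\<close> but is needed one round earlier, so all walks that matter stay short
  enough for parities to be well defined.\<close>

lemma state_after_lift:
  assumes closed: "\<And>k x. odd k \<Longrightarrow> k \<le> 2 * T \<Longrightarrow> (x, x) \<notin> R ^^ k"
    and "(x, v div 2) \<in> R ^^ k" "k + s \<le> T" "v < n"
  shows "state_after A {..<n} (lift_ports R True) \<omega> s v =
    state_after A {..<n} (lift_ports R False) (\<lambda>v\<in>{..<n}. \<omega> (switch x T v)) s (switch x T v)"
  using assms(2-)
proof (induction s arbitrary: v k)
  case 0
  then show ?case by (simp add: switch_less lift_ports_def)
next
  case (Suc s)
  let ?S1 = "state_after A {..<n} (lift_ports R True) \<omega> s"
  let ?S2 = "state_after A {..<n} (lift_ports R False) (\<lambda>v\<in>{..<n}. \<omega> (switch x T v)) s"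
  let ?nb = "sorted_list_of_set (R `` {v div 2})"
  have here: "?S1 v = ?S2 (switch x T v)"
    by (rule Suc.IH) (use Suc.prems in auto)
  have odd_v: "odd_from x T (v div 2) \<longleftrightarrow> odd k"
    by (rule odd_from_iff[OF closed]) (use Suc.prems in auto)
  have nbs: "send A (?S1 (2 * y + of_bool (odd v \<noteq> True))) (port_to (lift_ports R True) (2 * y + of_bool (odd v \<noteq> True)) v)
    = send A (?S2 (2 * y + of_bool (odd (switch x T v) \<noteq> False)))
        (port_to (lift_ports R False) (2 * y + of_bool (odd (switch x T v) \<noteq> False)) (switch x T v))"
    if y: "y \<in> set ?nb" for y
  proof -
    have yR: "(v div 2, y) \<in> R" using y finite_neighbours by simp
    define u where "u = 2 * y + of_bool (odd v \<noteq> True)"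
    have u: "u div 2 = y" "odd u \<longleftrightarrow> even v" by (auto simp: u_def)
    have walk: "(x, u div 2) \<in> R ^^ Suc k" using Suc.prems(1) yR u by auto
    have odd_u: "odd_from x T (u div 2) \<longleftrightarrow> odd (Suc k)"
      by (rule odd_from_iff[OF closed walk]) (use Suc.prems in auto)
    have vu: "(v, u) \<in> lift R True" using yR u by (auto simp: lift_def)
    \<comment> \<open>Along an edge both the sheet in the double cover and the parity of the walk
      change, so after switching both ends lie on the same sheet.\<close>
    have su: "2 * y + of_bool (odd (switch x T v) \<noteq> False) = switch x T u"
      unfolding double_plus_of_bool_eq_iff using u odd_u odd_v by simp
    have vu': "(switch x T v, switch x T u) \<in> lift R False"
      unfolding lift_def using u odd_u odd_v yR by simp
    have "?S1 u = ?S2 (switch x T u)"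
      by (rule Suc.IH[OF walk]) (use Suc.prems lift_less[OF vu] in auto)
    then show ?thesis
      unfolding su u_def[symmetric] by (simp add: port_to_lift[OF vu] port_to_lift[OF vu'])
  qed
  show ?case
    unfolding state_after.simps here
    by (intro arg_cong2[of _ _ _ _ "recv A"] refl)
       (use nbs in \<open>auto simp: lift_ports_def simp del: sorted_list_of_set\<close>)
qed

text \<open>All edges join the two sheets, so the even vertices are independent. For odd
  \<open>n\<close> they include the isolated vertex \<open>n - 1\<close>.\<close>

lemma independence_number_double_cover: "real n / 2 \<le> real (independence_number {..<n} (lift_edges R True))"
proof -
  define I where "I = (\<lambda>x. 2 * x) ` {..<(n + 1) div 2}"
  have "independent_set {..<n} (lift_edges R True) I"
    by (auto simp: independent_set_def I_def in_lift_edges_iff sym lift_def)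
  moreover have "finite {I. independent_set {..<n} (lift_edges R True) I}"
    by (rule finite_subset[of _ "Pow {..<n}"]) (auto simp: independent_set_def)
  ultimately have "card I \<le> independence_number {..<n} (lift_edges R True)"
    unfolding independence_number_def by (intro Max_ge) auto
  moreover have "card I = (n + 1) div 2"
    unfolding I_def by (subst card_image) (auto simp: inj_on_def)
  ultimately show ?thesis by linarith
qed

text \<open>On each sheet the set projects injectively to an independent set of the base; the 1
  covers the vertex left over for odd \<open>n\<close>.\<close>

lemma card_independent_two_copies_le:
  assumes base: "\<And>I. I \<subseteq> {..<n div 2} \<Longrightarrow> (\<And>x y. x \<in> I \<Longrightarrow> y \<in> I \<Longrightarrow> (x, y) \<notin> R) \<Longrightarrow> real (card I) \<le> a"
    and I: "independent_set {..<n} (lift_edges R False) I"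
  shows "real (card I) \<le> 2 * a + 1"
proof -
  define J where "J b = {x \<in> {..<n div 2}. 2 * x + of_bool b \<in> I}" for b
  have J: "real (card (J b)) \<le> a" for b
  proof (rule base)
    fix x y assume "x \<in> J b" "y \<in> J b"
    then have "(2 * x + of_bool b, 2 * y + of_bool b) \<notin> lift R False"
      using I by (auto simp: independent_set_def J_def in_lift_edges_iff sym)
    then show "(x, y) \<notin> R" by (auto simp: lift_def)
  qed (auto simp: J_def)
  have "I \<subseteq> (\<lambda>x. 2 * x + of_bool False) ` J False \<union> (\<lambda>x. 2 * x + of_bool True) ` J True \<union> {n - 1}"
  proof
    fix v assume v: "v \<in> I"
    then have "v < n" using I by (auto simp: independent_set_def)
    show "v \<in> (\<lambda>x. 2 * x + of_bool False) ` J False \<union> (\<lambda>x. 2 * x + of_bool True) ` J True \<union> {n - 1}"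
    proof (cases "v div 2 < n div 2")
      case True
      have *: "v = 2 * (v div 2) + of_bool (odd v)" by (cases "odd v") auto
      then have "v div 2 \<in> J (odd v)" using v True by (simp add: J_def)
      with * have "v \<in> (\<lambda>x. 2 * x + of_bool (odd v)) ` J (odd v)" by (rule image_eqI)
      then show ?thesis by (cases "odd v") auto
    next
      case False
      then have "v = n - 1" using \<open>v < n\<close> by linarith
      then show ?thesis by simp
    qed
  qed
  then have "card I \<le> card ((\<lambda>x. 2 * x + of_bool False) ` J False \<union> (\<lambda>x. 2 * x + of_bool True) ` J True \<union> {n - 1})"
    by (rule card_mono[rotated]) (auto simp: J_def)
  also have "\<dots> \<le> card (J False) + card (J True) + 1"
    by (intro order_trans[OF card_Un_le] add_mono card_image_le) (auto simp: J_def)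
  finally show ?thesis using J[of False] J[of True] by linarith
qed

end

section \<open>Acceptance probabilities and the expected size of the output\<close>

definition accepts ::
  "('s, 'm) local_algorithm \<Rightarrow> 'v set \<Rightarrow> ('v \<Rightarrow> 'v list) \<Rightarrow> nat \<Rightarrow> ('v \<Rightarrow> nat \<Rightarrow> bool) \<Rightarrow> 'v \<Rightarrow> bool" where
  "accepts A V p t \<omega> v \<longleftrightarrow> (\<exists>s\<le>t. decision A (state_after A V p \<omega> s v) = Some True \<and>
     (\<forall>s'<s. decision A (state_after A V p \<omega> s' v) = None))"

text \<open>First decisions fall within the first \<open>t\<close> rounds, so the output becomes an
  event of those rounds only, which are the ones the coupling controls.\<close>

lemma output_set_eq_accepts:
  assumes "\<forall>v\<in>V. decided_by A V p \<omega> t v"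
  shows "output_set A V p \<omega> = {v \<in> V. accepts A V p t \<omega> v}"
proof -
  have "s \<le> t" if "v \<in> V" "\<forall>s'<s. decision A (state_after A V p \<omega> s' v) = None" for v s
  proof -
    obtain s0 where "s0 \<le> t" "decision A (state_after A V p \<omega> s0 v) \<noteq> None"
      using assms \<open>v \<in> V\<close> by (auto simp: decided_by_def)
    with that(2) show ?thesis by (metis le_trans not_le)
  qed
  then show ?thesis unfolding output_set_def accepts_def by blast
qed

lemma prob_space_coin_flips: "prob_space coin_flips"
  unfolding coin_flips_def by (intro prob_space_PiM measure_pmf.prob_space_axioms)

lemma prob_space_random_bits: "prob_space (random_bits V)"
  unfolding random_bits_def by (intro prob_space_PiM prob_space_coin_flips)

lemma measurable_decision_eq:
  assumes "(\<lambda>\<omega>. decision A (state_after A V p \<omega> t v)) \<in> M \<rightarrow>\<^sub>M count_space UNIV"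
  shows "Measurable.pred M (\<lambda>\<omega>. decision A (state_after A V p \<omega> t v) = c)"
  using measurable_compose[OF assms, of "\<lambda>d. d = c" "count_space UNIV"] by simp

text \<open>Almost surely the output is the set of accepting vertices; linearity of expectation then
  leaves one probability per vertex.\<close>

lemma expected_card_output_set:
  fixes V :: "nat set"
  assumes A: "randomized_local_algorithm A"
    and G: "simple_graph V E" "port_numbering V E p"
    and t: "AE \<omega> in random_bits V. \<forall>v\<in>V. decided_by A V p \<omega> t v"
  shows "(\<integral>\<omega>. real (card (output_set A V p \<omega>)) \<partial>random_bits V)
     = (\<Sum>v\<in>V. measure (random_bits V) {\<omega> \<in> space (random_bits V). accepts A V p t \<omega> v})"
    and "v \<in> V \<Longrightarrow> {\<omega> \<in> space (random_bits V). accepts A V p t \<omega> v} \<in> sets (random_bits V)"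
proof -
  interpret prob_space "random_bits V" by (rule prob_space_random_bits)
  have finV: "finite V" using G by (simp add: simple_graph_def)
  have m [measurable]: "Measurable.pred (random_bits V) (\<lambda>\<omega>. decision A (state_after A V p \<omega> s v) = c)"
    if "v \<in> V" for s v c
    by (rule measurable_decision_eq) (use A G that in \<open>auto simp: randomized_local_algorithm_def\<close>)
  have acc: "Measurable.pred (random_bits V) (\<lambda>\<omega>. accepts A V p t \<omega> v)" if "v \<in> V" for v
    unfolding accepts_def using that by measurable
  then show sets: "v \<in> V \<Longrightarrow> {\<omega> \<in> space (random_bits V). accepts A V p t \<omega> v} \<in> sets (random_bits V)" for v
    by (simp add: pred_def)
  have out: "Measurable.pred (random_bits V) (\<lambda>\<omega>. \<exists>s. decision A (state_after A V p \<omega> s v) = Some True \<and>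
     (\<forall>s'<s. decision A (state_after A V p \<omega> s' v) = None))" if "v \<in> V" for v
    using that by measurable
  have card_out: "real (card (output_set A V p \<omega>)) =
      (\<Sum>v\<in>V. of_bool (\<exists>s. decision A (state_after A V p \<omega> s v) = Some True \<and>
     (\<forall>s'<s. decision A (state_after A V p \<omega> s' v) = None)))" for \<omega>
    using finV by (simp add: output_set_def Int_def)
  have "(\<integral>\<omega>. real (card (output_set A V p \<omega>)) \<partial>random_bits V)
    = (\<integral>\<omega>. (\<Sum>v\<in>V. indicator {\<omega> \<in> space (random_bits V). accepts A V p t \<omega> v} \<omega>) \<partial>random_bits V)"
  proof (rule integral_cong_AE)
    show "(\<lambda>\<omega>. real (card (output_set A V p \<omega>))) \<in> borel_measurable (random_bits V)"
      unfolding card_out of_bool_def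
      by (intro borel_measurable_sum measurable_If measurable_const) (simp_all add: out[unfolded pred_def])
    show "(\<lambda>\<omega>. \<Sum>v\<in>V. indicator {\<omega> \<in> space (random_bits V). accepts A V p t \<omega> v} \<omega> :: real)
        \<in> borel_measurable (random_bits V)"
      by (intro borel_measurable_sum borel_measurable_indicator sets)
    show "AE \<omega> in random_bits V. real (card (output_set A V p \<omega>)) =
        (\<Sum>v\<in>V. indicator {\<omega> \<in> space (random_bits V). accepts A V p t \<omega> v} \<omega>)"
      using t AE_space
    proof eventually_elim
      case (elim \<omega>)
      then show ?case
        using finV by (simp add: output_set_eq_accepts indicator_def Int_def)
    qed
  qed
  also have "\<dots> = (\<Sum>v\<in>V. \<integral>\<omega>. indicator {\<omega> \<in> space (random_bits V). accepts A V p t \<omega> v} \<omega> \<partial>random_bits V)"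
    by (intro Bochner_Integration.integral_sum) (use sets in \<open>auto intro!: integrable_real_indicator simp: emeasure_eq_measure\<close>)
  also have "\<dots> = (\<Sum>v\<in>V. measure (random_bits V) {\<omega> \<in> space (random_bits V). accepts A V p t \<omega> v})"
    using sets by (intro sum.cong refl) (simp add: Int_def conj_commute)
  finally show "(\<integral>\<omega>. real (card (output_set A V p \<omega>)) \<partial>random_bits V)
     = (\<Sum>v\<in>V. measure (random_bits V) {\<omega> \<in> space (random_bits V). accepts A V p t \<omega> v})" .
qed

lemma distr_random_bits_permute:
  assumes "inj_on f V" "f ` V \<subseteq> V"
  shows "distr (random_bits V) (random_bits V) (\<lambda>\<omega>. \<lambda>v\<in>V. \<omega> (f v)) = random_bits V"
  unfolding random_bits_def using distr_PiM_reindex[of V "\<lambda>_. coin_flips" f V] assms prob_space_coin_flips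
  by auto

section \<open>Transfer from the double cover to the two copies\<close>

context base_graph
begin

text \<open>Switching around the base vertex of \<open>v\<close> fixes \<open>v\<close>, as no odd
  closed walk of length at most \<open>t\<close> passes through that base vertex. It permutes
  independent, identically distributed strings and therefore preserves the measure.\<close>

lemma measure_accepts_lift:
  assumes A: "randomized_local_algorithm A"
    and closed: "\<And>k x. odd k \<Longrightarrow> k \<le> 2 * t \<Longrightarrow> (x, x) \<notin> R ^^ k"
    and dec: "AE \<omega> in random_bits {..<n}. \<forall>v\<in>{..<n}. decided_by A {..<n} (lift_ports R False) \<omega> t v"
    and v: "v < n"
  shows "measure (random_bits {..<n}) {\<omega> \<in> space (random_bits {..<n}). accepts A {..<n} (lift_ports R True) t \<omega> v}
       = measure (random_bits {..<n}) {\<omega> \<in> space (random_bits {..<n}). accepts A {..<n} (lift_ports R False) t \<omega> v}"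
proof -
  define M where "M = random_bits {..<n}"
  define x where "x = v div 2"
  define h where "h \<omega> = (\<lambda>u\<in>{..<n}. \<omega> (switch x t u))" for \<omega> :: "nat \<Rightarrow> nat \<Rightarrow> bool"
  have inj: "inj_on (switch x t) {..<n}"
    by (rule inj_on_inverseI[of _ "switch x t"]) simp
  have img: "switch x t ` {..<n} \<subseteq> {..<n}" using switch_less by auto
  have distr: "distr M M h = M"
    unfolding M_def h_def by (rule distr_random_bits_permute[OF inj img])
  have h: "h \<in> M \<rightarrow>\<^sub>M M"
    unfolding M_def h_def random_bits_def
    by (intro measurable_restrict measurable_component_singleton) (use switch_less in auto)
  have fixed: "switch x t v = v"
  proof -
    have "\<not> odd_from x t x"
      using closed by (auto simp: odd_from_def)
    then show ?thesis by (cases "odd v") (auto simp: switch_def x_def)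
  qed
  have "state_after A {..<n} (lift_ports R True) \<omega> s v = state_after A {..<n} (lift_ports R False) (h \<omega>) s v"
    if "s \<le> t" for s \<omega>
    using state_after_lift[OF closed, where x = x and v = v and k = 0 and s = s and A = A and \<omega> = \<omega>] that v fixed by (simp add: x_def h_def)
  then have eq: "accepts A {..<n} (lift_ports R True) t \<omega> v = accepts A {..<n} (lift_ports R False) t (h \<omega>) v" for \<omega>
    unfolding accepts_def by (auto intro!: ex_cong)
  have sets: "{\<omega> \<in> space M. accepts A {..<n} (lift_ports R False) t \<omega> v} \<in> sets M"
    unfolding M_def
    by (rule expected_card_output_set(2)[OF A simple_graph_lift port_numbering_lift dec]) (use v in simp)
  have "measure M {\<omega> \<in> space M. accepts A {..<n} (lift_ports R False) t \<omega> v}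
     = measure (distr M M h) {\<omega> \<in> space M. accepts A {..<n} (lift_ports R False) t \<omega> v}"
    by (simp add: distr)
  also have "\<dots> = measure M (h -` {\<omega> \<in> space M. accepts A {..<n} (lift_ports R False) t \<omega> v} \<inter> space M)"
    by (rule measure_distr[OF h sets])
  also have "h -` {\<omega> \<in> space M. accepts A {..<n} (lift_ports R False) t \<omega> v} \<inter> space M
      = {\<omega> \<in> space M. accepts A {..<n} (lift_ports R True) t \<omega> v}"
    using measurable_space[OF h] by (auto simp: eq)
  finally show ?thesis by (simp add: M_def)
qed

lemma independent_bound_if_runs_within:
  assumes A: "randomized_local_algorithm A" "approximates_max_independent_set A \<epsilon>"
    and t: "runs_within A n t"
    and closed: "\<And>k x. odd k \<Longrightarrow> k \<le> 2 * t \<Longrightarrow> (x, x) \<notin> R ^^ k"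
    and base: "\<And>I. I \<subseteq> {..<n div 2} \<Longrightarrow> (\<And>x y. x \<in> I \<Longrightarrow> y \<in> I \<Longrightarrow> (x, y) \<notin> R) \<Longrightarrow> real (card I) \<le> a"
  shows "real n / 2 - \<epsilon> * n \<le> 2 * a + 1"
proof -
  interpret prob_space "random_bits {..<n}" by (rule prob_space_random_bits)
  let ?E = "\<lambda>d. \<integral>\<omega>. real (card (output_set A {..<n} (lift_ports R d) \<omega>)) \<partial>random_bits {..<n}"
  have dec: "AE \<omega> in random_bits {..<n}. \<forall>v\<in>{..<n}. decided_by A {..<n} (lift_ports R d) \<omega> t v" for d
    using t simple_graph_lift[of d] port_numbering_lift[of d] unfolding runs_within_def
    by (metis card_lessThan)
  have ap: "(AE \<omega> in random_bits {..<n}. independent_set {..<n} (lift_edges R d) (output_set A {..<n} (lift_ports R d) \<omega>)) \<and>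
     ?E d \<ge> real (independence_number {..<n} (lift_edges R d)) - \<epsilon> * real (card {..<n})" for d
    using A(2) simple_graph_lift[of d] port_numbering_lift[of d]
    unfolding approximates_max_independent_set_def by blast
  have "real n / 2 - \<epsilon> * n \<le> ?E True"
    using ap[of True] independence_number_double_cover by simp
  also have "?E True = ?E False"
    unfolding expected_card_output_set(1)[OF A(1) simple_graph_lift port_numbering_lift dec]
    by (intro sum.cong refl measure_accepts_lift[OF A(1) closed dec]) auto
  also have "\<dots> \<le> 2 * a + 1"
  proof -
    have bound: "AE \<omega> in random_bits {..<n}. real (card (output_set A {..<n} (lift_ports R False) \<omega>)) \<le> 2 * a + 1"
      using ap[of False] by (auto elim!: eventually_mono intro!: card_independent_two_copies_le base)
    show ?thesis
    proof (cases "integrable (random_bits {..<n}) (\<lambda>\<omega>. real (card (output_set A {..<n} (lift_ports R False) \<omega>)))")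
      case True
      then have "?E False \<le> (\<integral>\<omega>. 2 * a + 1 \<partial>random_bits {..<n})"
        by (intro integral_mono_AE bound) auto
      then show ?thesis by (simp add: prob_space)
    next
      case False
      \<comment> \<open>The integral of a non-integrable function is 0 by convention, so the bound
        itself must be non-negative.\<close>
      have "0 \<le> a" using base[of "{}"] by simp
      with False show ?thesis by (simp add: not_integrable_integral_eq)
    qed
  qed
  finally show ?thesis .
qed

end

section \<open>The lower bound\<close>

lemma rounds_lower_bound:
  fixes A :: "('s, 'm) local_algorithm" and \<epsilon> :: real and n t :: nat
  assumes \<epsilon>: "0 < \<epsilon>" "\<epsilon> \<le> 0.04"
    and A: "randomized_local_algorithm A" "approximates_max_independent_set A \<epsilon>"
    and t: "runs_within A n t"
  defines "s \<equiv> 20 * nat \<lfloor>1 / (4000 * \<epsilon>)\<rfloor> + 1"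
  assumes n: "n \<ge> 4 * s * (40000 + 1000 * s)"
  shows "ln n / (1000000 * \<epsilon>) \<le> t"
proof (rule ccontr)
  assume "\<not> ?thesis"
  then have t_less: "t < ln n / (1000000 * \<epsilon>)" by simp
  \<comment> \<open>Chosen so that the error on the inner vertices,
    \<open>40 * \<epsilon> * q * m\<close>, is at most m/100. For \<epsilon> > 1/4000 it is 0 and
    nothing is subdivided.\<close>
  define q where "q = nat \<lfloor>1 / (4000 * \<epsilon>)\<rfloor>"
  define w where "w = n div 2"
  \<comment> \<open>Each base vertex accounts for 10 slots with \<open>2 * q\<close> inner vertices
    each, hence \<open>s = 20 * q + 1\<close> vertices in all; the remainder \<open>r\<close>
    becomes padding.\<close>
  define m where "m = w div s"
  define r where "r = w mod s"
  \<comment> \<open>The largest \<open>L\<close> with \<open>180 ^ L \<le> sqrt m\<close>; this is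
    the source of the logarithm in the bound.\<close>
  define L where "L = nat \<lfloor>ln m / (2 * ln 180)\<rfloor>"
  have s: "s = 20 * q + 1" by (simp add: s_def q_def)
  then have s1: "s \<ge> 1" by simp
  have q_ge: "real (q + 1) \<ge> 1 / (4000 * \<epsilon>)" unfolding q_def by linarith
  have "real q \<le> 1 / (4000 * \<epsilon>)" unfolding q_def using \<epsilon> by simp
  then have q_le: "\<epsilon> * q \<le> 1 / 4000" using \<epsilon> by (simp add: field_simps)
  have w: "w = m + 2 * q * (10 * m) + r"
    using div_mult_mod_eq[of w s] by (simp add: m_def r_def s algebra_simps)
  have r: "r < s" using s1 by (simp add: r_def)
  have m_ge: "real n \<le> 4 * real s * real m"
  proof -
    have "w = s * m + r" by (simp add: m_def r_def)
    with r have "w \<le> s * m + s" by simp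
    moreover have "n \<le> 2 * w + 1" by (simp add: w_def)
    moreover have "n \<ge> 4 * s + 2"
    proof -
      have "4 * s + 2 \<le> 4 * s * 40000" using s1 by linarith
      also have "\<dots> \<le> 4 * s * (40000 + 1000 * s)" by (intro mult_left_mono) auto
      also have "\<dots> \<le> n" by (rule n)
      finally show ?thesis .
    qed
    ultimately have "n \<le> 4 * (s * m)" by linarith
    then have "real n \<le> real (4 * (s * m))" by (rule of_nat_mono)
    then show ?thesis by simp
  qed
  have m_big: "real m \<ge> 40000 + 1000 * real s"
  proof -
    have "4 * real s * (40000 + 1000 * real s) \<le> real n"
      using of_nat_mono[OF n, where 'a = real] by simp
    also note m_ge
    finally show ?thesis using s1 by simp
  qed
  have m0: "m > 0"
  proof -
    have "real m > 0" using m_big by linarith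
    then show ?thesis by simp
  qed
  have n0: "n > 0"
  proof -
    have "0 < 4 * s * (40000 + 1000 * s)" using s1 by simp
    with n show ?thesis by linarith
  qed
  have ln_m: "ln n \<le> 2 * ln m"
  proof -
    have "real n \<le> 4 * real s * real m" by (rule m_ge)
    also have "\<dots> \<le> real m * real m" by (intro mult_right_mono) (use m_big in auto)
    finally have "ln n \<le> ln (real m * real m)" using n0 by simp
    then show ?thesis using m0 by (simp add: ln_mult)
  qed
  have ln180: "ln 180 \<le> (8::real)"
  proof -
    have "(2::real) ^ 8 \<le> exp 1 ^ 8"
      by (intro power_mono) (use exp_ge_add_one_self[of 1] in auto)
    also have "\<dots> = exp (8::real)"
      using exp_of_nat_mult[of 8 "1::real"] by simp
    finally have "ln 180 \<le> ln (exp (8::real))"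
      by (subst ln_le_cancel_iff) auto
    then show ?thesis by simp
  qed
  have ln180_pos: "ln 180 > (0::real)" by simp
  have L_le: "180 ^ L \<le> sqrt m"
  proof -
    have "real L \<le> ln m / (2 * ln 180)"
      unfolding L_def using m_big by simp
    then have "real L * ln 180 \<le> ln m / 2" using ln180_pos by (simp add: field_simps)
    then have "ln (180 ^ L) \<le> ln (sqrt m)" using m0 by (simp add: ln_realpow ln_sqrt)
    then show ?thesis using m0 by (subst (asm) ln_le_cancel_iff) auto
  qed
  have L_pos: "L > 0"
  proof -
    have "ln (180 * 180) \<le> ln (real m)" using m_big m0 by (subst ln_le_cancel_iff) auto
    then have "2 * ln 180 \<le> ln (real m)" by (subst (asm) ln_mult) auto
    then have "1 \<le> ln m / (2 * ln 180)" using ln180_pos by (simp add: field_simps)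
    then show ?thesis unfolding L_def by linarith
  qed
  \<comment> \<open>Here \<open>L + 1\<close> is at least \<open>ln n / 32\<close>, from
    \<open>ln n \<le> 2 * ln m\<close> and \<open>ln 180 \<le> 8\<close>, and \<open>q + 1\<close>
    is at least \<open>1 / (4000 * \<epsilon>)\<close>. Their product
    \<open>ln n / (128000 * \<epsilon>)\<close> leaves ample room for the constant 1000000.\<close>
  have short: "2 * t < (2 * q + 1) * (L + 1)"
  proof -
    have ln_n: "ln n \<ge> 0" using n0 by simp
    have "ln n / 32 \<le> ln m / (2 * 8)" using ln_m by simp
    also have "\<dots> \<le> ln m / (2 * ln 180)"
      by (intro divide_left_mono) (use ln180 ln180_pos ln_n ln_m in auto)
    also have "\<dots> \<le> real (L + 1)" unfolding L_def by linarith
    finally have L_ge: "ln n / 32 \<le> real (L + 1)" .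
    have "2 * real t < ln n / (500000 * \<epsilon>)" using t_less by simp
    also have "\<dots> \<le> 1 / (4000 * \<epsilon>) * (ln n / 32)"
      using ln_n \<epsilon> by (simp add: field_simps)
    also have "\<dots> \<le> real (2 * q + 1) * real (L + 1)"
      by (intro mult_mono L_ge order_trans[OF q_ge]) (use ln_n in auto)
    finally have "real (2 * t) < real ((2 * q + 1) * (L + 1))"
      by (simp only: of_nat_mult of_nat_numeral)
    then show ?thesis by (simp only: of_nat_less_iff)
  qed
  have m_1600: "m > 1600"
  proof -
    have "real m > real 1600" using m_big by simp
    then show ?thesis by (simp only: of_nat_less_iff)
  qed
  obtain f B where f: "\<And>i. i < 10 * m \<Longrightarrow> f i \<in> {..<m} \<times> {..<m}"
    and base: "\<And>S. S \<subseteq> {..<m} \<Longrightarrow> real (card S) \<le> 0.45 * m + card {i \<in> {..<10*m} - B. f i \<in> S \<times> S}"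
    and sparse: "\<And>F. F \<subseteq> {..<10*m} - B \<Longrightarrow> F \<noteq> {} \<Longrightarrow> card F \<le> L \<Longrightarrow>
       card F < card (\<Union>i\<in>F. {fst (f i), snd (f i)})"
    by (rule sparse_multigraph_exists[OF m_1600 L_le]) blast
  define R where "R = subdivision m q f (10 * m) B"
  have "R \<subseteq> {..<m + 2 * q * (10 * m)} \<times> {..<m + 2 * q * (10 * m)}"
    unfolding R_def by (rule subdivision_subset[OF f])
  also have "\<dots> \<subseteq> {..<n div 2} \<times> {..<n div 2}"
    unfolding w_def[symmetric] w by auto
  finally have R: "R \<subseteq> {..<n div 2} \<times> {..<n div 2}" .
  interpret base_graph R n
  proof
    show "(x, x) \<notin> R" for x
      unfolding R_def by (rule subdivision_irrefl[OF f sparse L_pos])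
  qed (use R sym_subdivision in \<open>auto simp: R_def\<close>)
  have "real n / 2 - \<epsilon> * n \<le> 2 * (0.45 * m + q * (10 * m) + r) + 1"
  proof (rule independent_bound_if_runs_within[OF A t])
    show "(x, x) \<notin> R ^^ k" if "odd k" "k \<le> 2 * t" for k x
      unfolding R_def
      by (rule subdivision_no_odd_closed_walk[OF f sparse \<open>odd k\<close>]) (use short that in auto)
    show "real (card I) \<le> 0.45 * m + q * (10 * m) + r"
      if I: "I \<subseteq> {..<n div 2}" and indep: "\<And>x y. x \<in> I \<Longrightarrow> y \<in> I \<Longrightarrow> (x, y) \<notin> R" for I
    proof -
      have "I \<subseteq> {..<m + 2 * q * (10 * m) + r}" using I unfolding w_def[symmetric] w .
      from card_independent_subdivision_le[OF f base this indep[unfolded R_def]]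
      show ?thesis by simp
    qed
  qed
  moreover have "real w * (1 - 2 * \<epsilon>) \<le> real n / 2 - \<epsilon> * n"
  proof -
    have "real w * (1 - 2 * \<epsilon>) \<le> real n / 2 * (1 - 2 * \<epsilon>)"
      by (intro mult_right_mono) (use \<epsilon> in \<open>auto simp: w_def\<close>)
    then show ?thesis by (simp add: algebra_simps)
  qed
  \<comment> \<open>The gap is m/10. Of it \<epsilon> \<le> 0.04 uses at most 0.08 m on the base
    vertices and the choice of \<open>q\<close> at most 0.01 m on the inner ones; the remaining 0.01
    m exceeds the loss from padding since \<open>m\<close> is at least
    \<open>40000 + 1000 * s\<close>.\<close>
  moreover have "real w * (1 - 2 * \<epsilon>) > 2 * (0.45 * m + q * (10 * m) + r) + 1"
  proof -
    have "\<epsilon> * m \<le> 1 / 25 * m" using \<epsilon> by (intro mult_right_mono) auto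
    moreover have "\<epsilon> * r \<le> 1 / 25 * r" using \<epsilon> by (intro mult_right_mono) auto
    moreover have "\<epsilon> * q * m \<le> 1 / 4000 * m" using q_le by (intro mult_right_mono) auto
    moreover have "real w * (1 - 2 * \<epsilon>) = m + 20 * (real q * m) + r - 2 * (\<epsilon> * m) - 40 * (\<epsilon> * q * m) - 2 * (\<epsilon> * r)"
      by (simp add: w algebra_simps)
    moreover have "2 * (0.45 * m + q * (10 * m) + r) + 1 = 9 / 10 * real m + 20 * (real q * m) + 2 * real r + 1"
      by simp
    moreover have "real r < real s" using r by simp
    ultimately show ?thesis using m_big by linarith
  qed
  ultimately show False by linarith
qed

lemma ereal_le_round_complexity:
  assumes "\<And>t. runs_within A n t \<Longrightarrow> x \<le> real t"
  shows "ereal x \<le> ereal_of_enat (round_complexity A n)"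
proof (cases "\<exists>t. runs_within A n t")
  case True
  define t where "t = (LEAST t. runs_within A n t)"
  have t: "runs_within A n t" using True LeastI_ex unfolding t_def by metis
  have "round_complexity A n = enat t"
    unfolding round_complexity_def
  proof (rule antisym)
    show "(INF t\<in>{t. runs_within A n t}. enat t) \<le> enat t"
      using t by (intro INF_lower) simp
    show "enat t \<le> (INF t\<in>{t. runs_within A n t}. enat t)"
      by (intro INF_greatest) (auto simp: t_def intro: Least_le)
  qed
  then show ?thesis using assms[OF t] by simp
next
  case False
  then have "round_complexity A n = \<infinity>" by (simp add: round_complexity_def top_enat_def)
  then show ?thesis by simp
qed

theorem theoremB3:
  shows "\<exists>c::real. c > 0 \<and>
    (\<forall>\<epsilon>::real. 0 < \<epsilon> \<and> \<epsilon> \<le> 0.04 \<longrightarrow>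
      (\<exists>n0::nat. \<forall>A :: ('s, 'm) local_algorithm.
        randomized_local_algorithm A \<and> approximates_max_independent_set A \<epsilon> \<longrightarrow>
        (\<forall>n\<ge>n0. ereal_of_enat (round_complexity A n) \<ge> ereal (c * (ln (real n) / \<epsilon>)))))"
proof (intro exI[of _ "1 / 1000000"] conjI allI impI)
  fix \<epsilon> :: real
  assume \<epsilon>: "0 < \<epsilon> \<and> \<epsilon> \<le> 0.04"
  \<comment> \<open>The threshold for \<open>n\<close> is computed from \<epsilon> alone and is thus
    the same for all algorithms.\<close>
  define s where "s = 20 * nat \<lfloor>1 / (4000 * \<epsilon>)\<rfloor> + 1"
  have "ereal (1 / 1000000 * (ln (real n) / \<epsilon>)) \<le> ereal_of_enat (round_complexity A n)"
    if "randomized_local_algorithm A \<and> approximates_max_independent_set A \<epsilon>"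
      and "n \<ge> 4 * s * (40000 + 1000 * s)" for A :: "('s, 'm) local_algorithm" and n
  proof (rule ereal_le_round_complexity)
    fix t assume "runs_within A n t"
    then have "ln n / (1000000 * \<epsilon>) \<le> t"
      using that \<epsilon> unfolding s_def by (intro rounds_lower_bound[of \<epsilon> A n t]) simp_all
    then show "1 / 1000000 * (ln (real n) / \<epsilon>) \<le> real t" by simp
  qed
  then show "\<exists>n0::nat. \<forall>A :: ('s, 'm) local_algorithm.
        randomized_local_algorithm A \<and> approximates_max_independent_set A \<epsilon> \<longrightarrow>
        (\<forall>n\<ge>n0. ereal_of_enat (round_complexity A n) \<ge> ereal (1 / 1000000 * (ln (real n) / \<epsilon>)))"
    by (intro exI[of _ "4 * s * (40000 + 1000 * s)"] allI impI)
qed simp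

end
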